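(* Let $\mu$ be a self-similar measure on $\mathbb{R}$ that satisfies the weak separation condition and has support $[0,1]$. Suppose that $\Phi$ is an increasing, doubling dimension function. Then $\overline{\dim}_\Phi\mu<\infty$ if and only if $\mu$ is $\Phi$-doubling.
   Context: Let $S_j(x)=r_jx+d_j$, $0<|r_j|<1$, $j=0,\dots,m$ ($m\ge1$), be similarities of $\mathbb{R}$ (an IFS), and let $p_j>0$ with $\sum_{j=0}^m p_j=1$. The associated self-similar measure is the unique Borel probability measure $\mu$ with $\mu(E)=\sum_j p_j\,\mu(S_j^{-1}(E))$ for all Borel $E$; its support is the unique non-empty compact $K$ with $K=\bigcup_j S_j(K)$. For a finite word $w=(j_1,\dots,j_n)$ on $\{0,\dots,m\}$ let $w^-=(j_1,\dots,j_{n-1})$, $S_w=S_{j_1}\circ\cdots\circ S_{j_n}$, $r_w=\prod_i r_{j_i}$; let $r_{\min}=\min_j|r_j|$ and $\Lambda_n=\{w:|r_w|\le r_{\min}^n \text{ and } |r_{w^-}|>r_{\min}^n\}$. The IFS and $\mu$ satisfy the weak separation condition if there are $x_0\in\mathbb{R}$ and an integer $M$ such that for any $n\in\mathbb{N}$ and finite word $\tau$, any closed ball of radius $r_{\min}^n$ contains no more than $M$ distinct points of the form $S_\sigma(S_\tau(x_0))$ with $\sigma\in\Lambda_n$. A dimension function is a map $\Phi:(0,1)\to[0,\infty)$ such that $x^{1+\Phi(x)}$ decreases to $0$ as $x$ decreases to $0$. The function $\Phi$ is doubling if there is $c>0$ with $\Phi(x)\le c\,\Phi(x/2)$ for all $x\in(0,1)$.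 The measure $\mu$ is $\Phi$-doubling if there are constants $C\ge1$, $\gamma>0$ such that $\mu(B(x,R))\le CR^{-\gamma\Phi(R)}\mu(B(x,R/2))$ for all $x\in\mathrm{supp}\,\mu$ and $0<R<1$, where $B(x,R)$ is the open ball. $\overline{\dim}_\Phi\mu$ is the infimum of all $\alpha$ for which there exist $C_1,C_2>0$ such that for all $0<r<R^{1+\Phi(R)}\le R\le C_1$ and all $x\in\mathrm{supp}\,\mu$, $\mu(B(x,R))/\mu(B(x,r))\le C_2(R/r)^\alpha$. *)

theory Defs
  imports "HOL-Probability.Probability"
begin

text \<open>
  An IFS is given by \<open>m\<close> and sequences \<open>r\<close>, \<open>d\<close>, of which only the entries with index at
  most \<open>m\<close> matter; likewise for the probabilities \<open>p\<close>.
\<close>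

definition sim :: "(nat \<Rightarrow> real) \<Rightarrow> (nat \<Rightarrow> real) \<Rightarrow> nat \<Rightarrow> real \<Rightarrow> real" where
  "sim r d j x = r j * x + d j"

definition is_ifs :: "nat \<Rightarrow> (nat \<Rightarrow> real) \<Rightarrow> bool" where
  "is_ifs m r \<longleftrightarrow> 1 \<le> m \<and> (\<forall>j\<le>m. 0 < \<bar>r j\<bar> \<and> \<bar>r j\<bar> < 1)"

definition is_prob_vector :: "nat \<Rightarrow> (nat \<Rightarrow> real) \<Rightarrow> bool" where
  "is_prob_vector m p \<longleftrightarrow> (\<forall>j\<le>m. 0 < p j) \<and> (\<Sum>j\<le>m. p j) = 1"

definition self_similar_measure ::
  "nat \<Rightarrow> (nat \<Rightarrow> real) \<Rightarrow> (nat \<Rightarrow> real) \<Rightarrow> (nat \<Rightarrow> real) \<Rightarrow> real measure \<Rightarrow> bool" where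
  "self_similar_measure m r d p \<mu> \<longleftrightarrow>
     is_ifs m r \<and> is_prob_vector m p \<and> prob_space \<mu> \<and> sets \<mu> = sets borel \<and>
     (\<forall>E\<in>sets borel. measure \<mu> E = (\<Sum>j\<le>m. p j * measure \<mu> (sim r d j -` E)))"

definition msupport :: "real measure \<Rightarrow> real set" where
  "msupport \<mu> = {x. \<forall>U. open U \<and> x \<in> U \<longrightarrow> 0 < emeasure \<mu> U}"

definition words :: "nat \<Rightarrow> nat list set" where
  "words m = {w. set w \<subseteq> {..m}}"

definition word_map :: "(nat \<Rightarrow> real) \<Rightarrow> (nat \<Rightarrow> real) \<Rightarrow> nat list \<Rightarrow> real \<Rightarrow> real" where
  "word_map r d w = foldr (\<lambda>j f. sim r d j \<circ> f) w id"

definition word_ratio :: "(nat \<Rightarrow> real) \<Rightarrow> nat list \<Rightarrow> real" where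
  "word_ratio r w = prod_list (map r w)"

definition r_min :: "nat \<Rightarrow> (nat \<Rightarrow> real) \<Rightarrow> real" where
  "r_min m r = Min ((\<lambda>j. \<bar>r j\<bar>) ` {..m})"

definition Lambda :: "nat \<Rightarrow> (nat \<Rightarrow> real) \<Rightarrow> nat \<Rightarrow> nat list set" where
  "Lambda m r n = {w \<in> words m. w \<noteq> [] \<and>
     \<bar>word_ratio r w\<bar> \<le> r_min m r ^ n \<and> \<bar>word_ratio r (butlast w)\<bar> > r_min m r ^ n}"

definition weak_separation :: "nat \<Rightarrow> (nat \<Rightarrow> real) \<Rightarrow> (nat \<Rightarrow> real) \<Rightarrow> bool" where
  "weak_separation m r d \<longleftrightarrow>
     (\<exists>x0::real. \<exists>M::nat. \<forall>n. \<forall>\<tau>\<in>words m. \<forall>y.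
        let P = {word_map r d \<sigma> (word_map r d \<tau> x0) |\<sigma>. \<sigma> \<in> Lambda m r n} \<inter> cball y (r_min m r ^ n)
        in finite P \<and> card P \<le> M)"

text \<open>
  A function on the open unit interval is represented by a total function; its values elsewhere
  are arbitrary and never used.
\<close>

definition dimension_function :: "(real \<Rightarrow> real) \<Rightarrow> bool" where
  "dimension_function \<Phi> \<longleftrightarrow>
     (\<forall>x\<in>{0<..<1}. 0 \<le> \<Phi> x) \<and>
     mono_on {0<..<1} (\<lambda>x. x powr (1 + \<Phi> x)) \<and>
     ((\<lambda>x. x powr (1 + \<Phi> x)) \<longlongrightarrow> 0) (at_right 0)"

definition doubling_function :: "(real \<Rightarrow> real) \<Rightarrow> bool" where
  "doubling_function \<Phi> \<longleftrightarrow> (\<exists>c>0. \<forall>x\<in>{0<..<1}. \<Phi> x \<le> c * \<Phi> (x / 2))"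

definition Phi_doubling :: "(real \<Rightarrow> real) \<Rightarrow> real measure \<Rightarrow> bool" where
  "Phi_doubling \<Phi> \<mu> \<longleftrightarrow>
     (\<exists>C \<gamma>. C \<ge> 1 \<and> \<gamma> > 0 \<and>
        (\<forall>x\<in>msupport \<mu>. \<forall>R. 0 < R \<and> R < 1 \<longrightarrow>
           measure \<mu> (ball x R) \<le> C * R powr (- \<gamma> * \<Phi> R) * measure \<mu> (ball x (R / 2))))"

text \<open>
  The guard \<open>R < 1\<close> keeps \<open>R\<close> in the domain of \<open>\<Phi>\<close>. The infimum is taken in the extended
  reals, so that it is \<open>\<infinity>\<close> when no exponent is admissible.
\<close>

definition upper_Phi_dim :: "(real \<Rightarrow> real) \<Rightarrow> real measure \<Rightarrow> ereal" where
  "upper_Phi_dim \<Phi> \<mu> = Inf {ereal \<alpha> |\<alpha>.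
     \<exists>C1>0. \<exists>C2>0. \<forall>r R. 0 < r \<and> r < R powr (1 + \<Phi> R) \<and> R powr (1 + \<Phi> R) \<le> R \<and> R \<le> C1 \<and> 0 < R \<and> R < 1 \<longrightarrow>
       (\<forall>x\<in>msupport \<mu>. measure \<mu> (ball x R) / measure \<mu> (ball x r) \<le> C2 * (R / r) powr \<alpha>)}"

end

theory Submission
  imports Defs
begin

text \<open>
  Suppose first that the upper \<open>\<Phi>\<close>-dimension is finite, with exponent \<open>\<alpha>\<close>. The defining
  inequality, applied to the single pair of radii \<open>R\<close> and \<open>R powr (1 + \<Phi> R) / 2\<close>, already is
  \<open>\<Phi>\<close>-doubling with \<open>\<gamma> = max \<alpha> 1\<close>: the quotient of these radii is \<open>2 * R powr (- \<Phi> R)\<close>, and the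
  smaller one is at most \<open>R / 2\<close>.

  The converse needs the geometry. Iterating \<open>\<Phi>\<close>-doubling from \<open>R\<close> down to a much smaller
  radius \<open>\<eta>\<close> would lose a factor \<open>R powr (- \<gamma> * \<Phi> R)\<close> at each of about \<open>log 2 (R / \<eta>)\<close> halvings, and
  this is not bounded by a power of \<open>R / \<eta>\<close>. Only a fixed number of halvings is affordable: since
  \<open>\<eta> < R powr (1 + \<Phi> R)\<close> gives \<open>R powr (- \<Phi> R) \<le> R / \<eta>\<close>, they cost a power of \<open>R / \<eta>\<close>. The rest of
  the way is bridged by self-similarity. At a scale \<open>t\<close> comparable to \<open>R\<close> the measure is the sum,
  over the distinct maps \<open>f\<close> of contraction ratio about \<open>t\<close>, of \<open>P f\<close> times the image of \<open>\<mu>\<close> under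
  \<open>f\<close>, where \<open>P f\<close> is the total weight of the stopping words that induce \<open>f\<close>. By weak separation
  a bounded number of maps meets any ball of radius \<open>t\<close> (\<open>card_near_bounded\<close>), so a single \<open>f\<close>
  carries a fixed proportion of the mass of such a ball. If \<open>x\<close> lies in \<open>f ` {0..1}\<close>, then
  \<open>ball x \<eta>\<close> has mass at least \<open>P f\<close> times the mass of a ball of radius \<open>\<eta> / t\<close>, and the latter
  is at least \<open>c * (\<eta> / t) powr s\<close> (\<open>measure_ball_lower_bound\<close>).

  The difficulty is that a heavy map near \<open>x\<close> need not cover \<open>x\<close>: the endpoint of its image may
  be very close to \<open>x\<close>, on the wrong side. This is resolved by \<open>ball_forcing_cover\<close>: within
  distance \<open>t\<close> of every \<open>x\<close> there is a ball of radius \<open>\<epsilon> * t\<close> such that every map of scale \<open>t\<close>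
  whose image meets that ball does cover \<open>x\<close>. Applying the bounded number of halvings at the centre
  of that ball, and then the lower bound above at \<open>x\<close>, gives the theorem.

  The ball exists because endpoints of images at scale \<open>t\<close> that can be compared with one
  common image are either equal or separated by a fixed multiple of \<open>t\<close>
  (\<open>separated_endpoints\<close>). That in turn comes from \<open>finite_relative_endpoints\<close>: two images at
  the same scale which overlap substantially are in one of finitely many relative positions. Here
  the connectedness of the support enters, through the following maximality argument. Choose a
  place and a scale at which the number of maps meeting a ball is as large as possible. The copy of
  this family under any \<open>S w\<close> is again of maximal size, hence consists of \<^emph>\<open>all\<close> maps
  that meet the corresponding ball. If the images of \<open>f\<close> and \<open>g\<close> overlap in an interval, a copy of
  the maximal family fits inside the overlap below \<open>f\<close>. Some descendant of \<open>g\<close> reaches the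
  same place, so it is a member of the copy, and this expresses \<open>g\<close> through \<open>f\<close> and finitely many
  words.
\<close>

section \<open>Words, ratios and intervals\<close>

lemma word_map_Nil [simp]: "word_map r d [] x = x"
  by (simp add: word_map_def)

lemma word_map_Cons [simp]: "word_map r d (j # w) x = r j * word_map r d w x + d j"
  by (simp add: word_map_def sim_def)

lemma word_map_append: "word_map r d (u @ v) x = word_map r d u (word_map r d v x)"
  by (induction u) auto

lemma word_ratio_simps [simp]:
  "word_ratio r [] = 1" "word_ratio r (j # w) = r j * word_ratio r w"
  "word_ratio r (u @ v) = word_ratio r u * word_ratio r v"
  "word_ratio r (replicate k j) = r j ^ k"
  by (simp_all add: word_ratio_def)

lemma word_map_diff: "word_map r d w x - word_map r d w y = word_ratio r w * (x - y)"
  by (induction w) (auto simp: mult.assoc simp flip: right_diff_distrib)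

lemma word_map_affine: "word_map r d w x = word_ratio r w * x + word_map r d w 0"
  using word_map_diff[of r d w x 0] by simp

lemma words_simps [simp]:
  "[] \<in> words m" "j # w \<in> words m \<longleftrightarrow> j \<le> m \<and> w \<in> words m"
  "u @ v \<in> words m \<longleftrightarrow> u \<in> words m \<and> v \<in> words m"
  by (auto simp: words_def)

lemma words_replicate: "j \<le> m \<Longrightarrow> replicate k j \<in> words m"
  by (auto simp: words_def)

lemma word_image_interval:
  fixes r d :: "nat \<Rightarrow> real"
  defines "S \<equiv> word_map r d"
  shows "S w ` {0..1} = {min (S w 0) (S w 1)..max (S w 0) (S w 1)}"
proof -
  obtain a c where S: "S w = (\<lambda>x. a * x + c)"
    unfolding S_def using word_map_affine by blast
  show ?thesis
    unfolding S using image_affinity_atLeastAtMost[of a c 0 1]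
    by (cases "0 \<le> a") (simp_all add: min_def max_def)
qed

text \<open>
  At most \<open>2 * \<lceil>C\<rceil> + 1\<close> translates of the small ball cover the large one.
\<close>

lemma card_Int_cball_scaled:
  fixes X :: "real set"
  assumes h: "0 < h" and C: "0 \<le> C"
    and M: "\<And>y. finite (X \<inter> cball y h) \<and> card (X \<inter> cball y h) \<le> M"
  shows "finite (X \<inter> cball y (C * h)) \<and>
    card (X \<inter> cball y (C * h)) \<le> card {- \<lceil>C\<rceil>..\<lceil>C\<rceil>} * M"
proof -
  let ?B = "\<lambda>i::int. X \<inter> cball (y + of_int i * h) h"
  have sub: "X \<inter> cball y (C * h) \<subseteq> (\<Union>i\<in>{- \<lceil>C\<rceil>..\<lceil>C\<rceil>}. ?B i)"
  proof
    fix z assume z: "z \<in> X \<inter> cball y (C * h)"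
    define i where "i = \<lfloor>(z - y) / h\<rfloor>"
    have a: "\<bar>(z - y) / h\<bar> \<le> C"
      using z h by (simp add: dist_real_def abs_minus_commute abs_divide field_simps)
    have "of_int i \<le> (z - y) / h" "(z - y) / h < of_int i + 1"
      unfolding i_def by linarith+
    hence "of_int i * h \<le> z - y" "z - y \<le> (of_int i + 1) * h"
      using h by (simp_all add: field_simps)
    hence "z \<in> ?B i" using z by (auto simp: dist_real_def algebra_simps abs_if)
    moreover have "i \<in> {- \<lceil>C\<rceil>..\<lceil>C\<rceil>}" proof -
      have "- real_of_int \<lceil>C\<rceil> \<le> (z - y) / h" "(z - y) / h \<le> real_of_int \<lceil>C\<rceil>" using a by linarith+
      thus ?thesis unfolding i_def by (simp add: le_floor_iff floor_le_iff)
    qed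
    ultimately show "z \<in> (\<Union>i\<in>{- \<lceil>C\<rceil>..\<lceil>C\<rceil>}. ?B i)" by blast
  qed
  have fin: "finite (\<Union>i\<in>{- \<lceil>C\<rceil>..\<lceil>C\<rceil>}. ?B i)" using M by blast
  have "card (X \<inter> cball y (C * h)) \<le> card (\<Union>i\<in>{- \<lceil>C\<rceil>..\<lceil>C\<rceil>}. ?B i)"
    using card_mono[OF fin sub] .
  also have "\<dots> \<le> (\<Sum>i\<in>{- \<lceil>C\<rceil>..\<lceil>C\<rceil>}. card (?B i))"
    by (rule card_UN_le) simp
  also have "\<dots> \<le> card {- \<lceil>C\<rceil>..\<lceil>C\<rceil>} * M"
    using sum_bounded_above[of "{- \<lceil>C\<rceil>..\<lceil>C\<rceil>}" "\<lambda>i. card (?B i)" M] M by auto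
  finally show ?thesis using finite_subset[OF sub fin] by simp
qed

section \<open>An iterated function system on the unit interval\<close>

locale interval_ifs =
  fixes m :: nat and r d :: "nat \<Rightarrow> real"
  assumes ifs: "is_ifs m r"
    and cover: "(\<Union>j\<le>m. sim r d j ` {0..1}) = {0..1}"
begin

abbreviation "S \<equiv> word_map r d"
abbreviation "\<rho> w \<equiv> \<bar>word_ratio r w\<bar>"
abbreviation "rm \<equiv> r_min m r"

lemma r_bounds: "j \<le> m \<Longrightarrow> 0 < \<bar>r j\<bar> \<and> \<bar>r j\<bar> < 1"
  using ifs by (auto simp: is_ifs_def)

lemma rm_le: "j \<le> m \<Longrightarrow> rm \<le> \<bar>r j\<bar>"
  unfolding r_min_def by (intro Min_le) auto

lemma rm_pos: "0 < rm"
  unfolding r_min_def using r_bounds by (subst Min_gr_iff) auto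

lemma rm_less_1: "rm < 1"
  using rm_le[of 0] r_bounds[of 0] by simp

lemma \<rho>_pos: "w \<in> words m \<Longrightarrow> 0 < \<rho> w"
  using r_bounds by (induction w) auto

lemma \<rho>_le_1: "w \<in> words m \<Longrightarrow> \<rho> w \<le> 1"
  using r_bounds by (induction w) (auto simp: abs_mult mult_le_one less_imp_le)

lemma S_dist: "\<bar>S w x - S w y\<bar> = \<rho> w * \<bar>x - y\<bar>"
  by (simp add: word_map_diff abs_mult)

lemma S_inj: "w \<in> words m \<Longrightarrow> S w x = S w y \<longleftrightarrow> x = y"
  using \<rho>_pos[of w] S_dist[of w x y] by auto

lemma S_in_unit: "w \<in> words m \<Longrightarrow> x \<in> {0..1} \<Longrightarrow> S w x \<in> {0..1}"
proof (induction w)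
  case (Cons j w)
  hence "j \<le> m" "S w x \<in> {0..1}" by auto
  hence "sim r d j (S w x) \<in> (\<Union>j\<le>m. sim r d j ` {0..1})" by blast
  thus ?case unfolding cover by (simp add: sim_def)
qed auto

lemma uniform_contraction: "\<exists>q. 0 < q \<and> q < 1 \<and> (\<forall>j\<le>m. \<bar>r j\<bar> \<le> q)"
proof -
  define q where "q = Max ((\<lambda>j. \<bar>r j\<bar>) ` {..m})"
  have q: "\<bar>r j\<bar> \<le> q" if "j \<le> m" for j
    unfolding q_def using that by (intro Max_ge) auto
  have q1: "q < 1" unfolding q_def using r_bounds by (subst Max_less_iff) auto
  have "0 < \<bar>r 0\<bar>" "\<bar>r 0\<bar> \<le> q" using q[of 0] r_bounds[of 0] by auto
  hence "0 < q" by linarith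
  thus ?thesis using q q1 by blast
qed

text \<open>
  Ratios decay exponentially with the length of the word, so a lower bound on the ratio is an
  upper bound on the length.
\<close>

lemma finite_words_bounded_ratio:
  assumes "0 < c"
  shows "finite {w \<in> words m. c \<le> \<rho> w}"
proof -
  obtain q where q0: "0 < q" and q1: "q < 1" and q: "\<And>j. j \<le> m \<Longrightarrow> \<bar>r j\<bar> \<le> q"
    using uniform_contraction by blast
  have le: "\<rho> w \<le> q ^ length w" if "w \<in> words m" for w
    using that
  proof (induction w)
    case (Cons j w)
    thus ?case using q[of j] q0 by (auto simp: abs_mult intro!: mult_mono)
  qed simp
  obtain k where k: "q ^ k < c" using real_arch_pow_inv[OF assms q1] by blast
  have "{w \<in> words m. c \<le> \<rho> w} \<subseteq> {w. set w \<subseteq> {..m} \<and> length w \<le> k}"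
  proof clarify
    fix w assume w: "w \<in> words m" "c \<le> \<rho> w"
    have "q ^ k < q ^ length w" using le[OF w(1)] w(2) k by linarith
    hence "length w \<le> k" using q0 q1 power_strict_decreasing_iff[of q k "length w"] by linarith
    thus "set w \<subseteq> {..m} \<and> length w \<le> k" using w(1) by (simp add: words_def)
  qed
  thus ?thesis using finite_lists_length_le[of "{..m}" k] finite_subset by auto
qed

text \<open>
  Follow an address of \<open>z\<close> until the ratio first drops to \<open>t\<close>; the last letter shrinks it by a
  factor of at least \<open>rm\<close>. The induction is on a bound \<open>k\<close> for the length of that address.
\<close>

lemma ex_word_at_scale:
  assumes "0 < t" "t \<le> 1" "z \<in> {0..1}"
  shows "\<exists>w\<in>words m. z \<in> S w ` {0..1} \<and> rm * t < \<rho> w \<and> \<rho> w \<le> t"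
proof -
  obtain q where q0: "0 < q" and q1: "q < 1" and q: "\<And>j. j \<le> m \<Longrightarrow> \<bar>r j\<bar> \<le> q"
    using uniform_contraction by blast
  have "\<exists>w\<in>words m. z \<in> S w ` {0..1} \<and> rm * t < \<rho> w \<and> \<rho> w \<le> t"
    if "q ^ k \<le> t" "t \<le> 1" "z \<in> {0..1}" for k t z
    using that
  proof (induction k arbitrary: t z)
    case 0
    thus ?case using rm_less_1 by (intro bexI[of _ "[]"]) auto
  next
    case (Suc k)
    from Suc.prems(3) obtain j z' where j: "j \<le> m" "z' \<in> {0..1}" "z = sim r d j z'"
      using cover by blast
    have rj: "0 < \<bar>r j\<bar>" "\<bar>r j\<bar> \<le> q" "rm \<le> \<bar>r j\<bar>" using r_bounds q rm_le j by auto
    have t0: "0 < t" using Suc.prems(1) q0 zero_less_power[OF q0, of "Suc k"] by linarith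
    consider "t = 1" | "t < 1" "\<bar>r j\<bar> < t" | "t \<le> \<bar>r j\<bar>" using Suc.prems(2) by linarith
    thus ?case
    proof cases
      case 1
      thus ?thesis using rm_less_1 Suc.prems by (intro bexI[of _ "[]"]) auto
    next
      case 2
      have "rm * t < rm" using 2 rm_pos by simp
      hence "rm * t < \<bar>r j\<bar>" using rj by linarith
      thus ?thesis using 2 j by (intro bexI[of _ "[j]"]) (auto simp: sim_def image_iff)
    next
      case 3
      have "q ^ k * \<bar>r j\<bar> \<le> q ^ k * q" using rj q0 by (intro mult_left_mono) auto
      hence "q ^ k \<le> t / \<bar>r j\<bar>" using rj(1) Suc.prems(1) by (simp add: pos_le_divide_eq mult.commute)
      from Suc.IH[OF this _ j(2)] obtain w where
        w: "w \<in> words m" "z' \<in> S w ` {0..1}" "rm * (t / \<bar>r j\<bar>) < \<rho> w" "\<rho> w \<le> t / \<bar>r j\<bar>"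
        using 3 rj by auto
      thus ?thesis using j rj
        by (intro bexI[of _ "j # w"]) (auto simp: sim_def abs_mult field_simps)
    qed
  qed
  moreover obtain k where "q ^ k < t" using real_arch_pow_inv[OF assms(1) q1] by blast
  ultimately show ?thesis using assms by (metis less_imp_le)
qed

section \<open>Counting the maps of one scale\<close>

text \<open>
  Unlike the stopping condition of \<open>Lambda\<close>, this condition ignores the prefixes of \<open>w\<close>, and
  the scale is an arbitrary real number. Hence composing with \<open>S u\<close> carries maps of scale \<open>t\<close> to
  maps of scale \<open>t * \<rho> u\<close>, which is what the maximality argument needs.
\<close>

definition maps_at :: "real \<Rightarrow> (real \<Rightarrow> real) set" where
  "maps_at t = {S w |w. w \<in> words m \<and> rm * t < \<rho> w \<and> \<rho> w \<le> t}"

definition near :: "real \<Rightarrow> real \<Rightarrow> (real \<Rightarrow> real) set" where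
  "near t y = {f \<in> maps_at t. f ` {0..1} \<inter> cball y t \<noteq> {}}"

text \<open>
  If all the similarities fixed \<open>x0\<close>, they would all move points strictly closer to \<open>x0\<close>, and the
  point of the unit interval farthest from \<open>x0\<close> would not be covered.
\<close>

lemma no_common_fixed_point: "\<exists>j\<le>m. sim r d j x0 \<noteq> x0"
proof (rule ccontr)
  assume "\<not> ?thesis"
  hence fix0: "sim r d j x0 = x0" if "j \<le> m" for j using that by blast
  define z where "z = (if x0 \<le> 1/2 then 1 else 0 :: real)"
  have z: "z \<in> {0..1}" "\<bar>z - x0\<bar> > 0" "\<And>u. u \<in> {0..1} \<Longrightarrow> \<bar>u - x0\<bar> \<le> \<bar>z - x0\<bar>"
    by (auto simp: z_def)
  obtain j u where j: "j \<le> m" "u \<in> {0..1}" "z = sim r d j u" using cover z(1) by blast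
  have "z - x0 = r j * (u - x0)" using fix0[OF j(1)] j(3) by (simp add: sim_def algebra_simps)
  hence eq: "\<bar>z - x0\<bar> = \<bar>r j\<bar> * \<bar>u - x0\<bar>" by (simp add: abs_mult)
  also have "\<dots> \<le> \<bar>r j\<bar> * \<bar>z - x0\<bar>" using z(3)[OF j(2)] by (intro mult_left_mono) auto
  finally show False using r_bounds[OF j(1)] z(2) by (simp add: mult_le_cancel_right1)
qed

text \<open>
  Weak separation speaks about stopping words only. A word of scale \<open>t\<close> becomes one after
  appending zeros, and the number of zeros is bounded uniformly in \<open>t\<close>.
\<close>

lemma Lambda_extension:
  assumes w: "w \<in> words m" "rm * t < \<rho> w" "\<rho> w \<le> t" and t: "0 < t"
    and n: "rm ^ n \<le> rm * t" "rm ^ n > rm\<^sup>2 * t"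
    and K: "\<bar>r 0\<bar> ^ K < rm\<^sup>2"
  shows "\<exists>k\<le>K. w @ replicate k 0 \<in> Lambda m r n"
proof -
  define b where "b = \<bar>r 0\<bar>"
  have b: "0 < b" "b < 1" using r_bounds[of 0] by (auto simp: b_def)
  let ?P = "\<lambda>k. \<rho> w * b ^ k \<le> rm ^ n"
  have "\<rho> w * b ^ K \<le> t * rm\<^sup>2"
    using w K t by (intro mult_mono) (auto simp: b_def)
  hence PK: "?P K" using n(2) by (simp add: mult.commute)
  define k where "k = (LEAST k. ?P k)"
  have k: "?P k" "k \<le> K" "\<And>i. i < k \<Longrightarrow> \<not> ?P i"
    unfolding k_def using PK by (auto intro: LeastI Least_le dest: not_less_Least)
  have "\<not> ?P 0" using w n by simp
  then obtain i where i: "k = Suc i" using k(1) by (cases k) auto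
  have "w @ replicate k 0 = (w @ replicate i 0) @ [0]"
    by (simp add: i replicate_append_same)
  hence bl: "butlast (w @ replicate k 0) = w @ replicate i 0"
    by (simp only: butlast_snoc)
  have "\<not> ?P i" "k > 0" using k(3) i by simp_all
  hence "w @ replicate k 0 \<in> Lambda m r n"
    using k(1) w(1) words_replicate[of 0 m] unfolding Lambda_def
    by (auto simp: bl abs_mult power_abs b_def)
  thus ?thesis using k(2) by blast
qed

text \<open>
  An affine map is determined by its values at two distinct points. Weak separation, used with the
  empty word and with a letter \<open>j\<close> that moves \<open>x0\<close>, bounds the number of possible values at the two
  points obtained from \<open>x0\<close> and \<open>sim r d j x0\<close>.
\<close>

lemma card_near_bounded:
  assumes "weak_separation m r d"
  shows "\<exists>N. \<forall>t y. 0 < t \<longrightarrow> t \<le> 1 \<longrightarrow> finite (near t y) \<and> card (near t y) \<le> N"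
proof -
  obtain x0 M where wsc: "\<forall>n. \<forall>\<tau>\<in>words m. \<forall>y.
      finite ({S \<sigma> (S \<tau> x0) |\<sigma>. \<sigma> \<in> Lambda m r n} \<inter> cball y (rm ^ n)) \<and>
      card ({S \<sigma> (S \<tau> x0) |\<sigma>. \<sigma> \<in> Lambda m r n} \<inter> cball y (rm ^ n)) \<le> M"
    using assms unfolding weak_separation_def Let_def by (elim exE) (rule that)
  obtain j where j: "j \<le> m" "sim r d j x0 \<noteq> x0" using no_common_fixed_point by blast
  define D where "D = max \<bar>x0\<bar> \<bar>S [j] x0\<bar>"
  \<comment> \<open>The two values that determine a map in \<open>near t y\<close> lie within \<open>(D + 3) * t\<close> of \<open>y\<close>, and
    the level \<open>n\<close> is chosen below such that \<open>t\<close> is less than \<open>rm ^ n\<close> divided by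
    the square of \<open>rm\<close>.\<close>
  define C where "C = (D + 3) / rm\<^sup>2"
  define L where "L = card {- \<lceil>C\<rceil>..\<lceil>C\<rceil>} * M"
  have C0: "0 \<le> C" by (simp add: C_def D_def)
  obtain K where K: "\<bar>r 0\<bar> ^ K < rm\<^sup>2"
    using real_arch_pow_inv[of "rm\<^sup>2" "\<bar>r 0\<bar>"] rm_pos r_bounds[of 0] by auto
  have "finite (near t y) \<and> card (near t y) \<le> Suc K * (L * L)" if t: "0 < t" "t \<le> 1" for t y
  proof -
    define n where "n = (LEAST n. rm ^ n \<le> rm * t)"
    have ex: "\<exists>n. rm ^ n \<le> rm * t"
      using real_arch_pow_inv[of "rm * t" rm] rm_pos rm_less_1 t by (auto intro: less_imp_le)
    have n1: "rm ^ n \<le> rm * t" unfolding n_def using LeastI_ex[OF ex] .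
    have "rm * t < 1" using t rm_pos rm_less_1 by (smt (verit) mult_left_le)
    hence "n \<noteq> 0" using n1 by (auto intro: ccontr)
    then obtain i where i: "n = Suc i" by (cases n) auto
    hence "\<not> rm ^ i \<le> rm * t" unfolding n_def using not_less_Least by (metis lessI)
    hence n2: "rm ^ n > rm\<^sup>2 * t" using rm_pos by (simp add: i power2_eq_square mult.assoc)
    define Q where "Q \<tau> = {S \<sigma> (S \<tau> x0) |\<sigma>. \<sigma> \<in> Lambda m r n} \<inter> cball y (C * rm ^ n)" for \<tau>
    have Q: "finite (Q \<tau>) \<and> card (Q \<tau>) \<le> L" if "\<tau> \<in> words m" for \<tau>
      unfolding Q_def L_def using rm_pos C0
      by (intro card_Int_cball_scaled wsc[rule_format] that) auto
    define v where "v k = replicate k (0::nat)" for k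
    have v: "v k \<in> words m" for k by (simp add: v_def words_replicate)
    have "\<exists>k\<le>K. f (S (v k) x0) \<in> Q [] \<and> f (S (v k) (S [j] x0)) \<in> Q [j]"
      if f: "f \<in> near t y" for f
    proof -
      obtain w where w: "w \<in> words m" "rm * t < \<rho> w" "\<rho> w \<le> t" "f = S w"
        using f by (auto simp: near_def maps_at_def)
      obtain k where k: "k \<le> K" "w @ v k \<in> Lambda m r n"
        using Lambda_extension[OF w(1-3) t(1) n1 n2 K] by (auto simp: v_def)
      obtain q where "q \<in> {0..1}" "f q \<in> cball y t"
        using f unfolding near_def by blast
      hence q: "q \<in> {0..1}" "\<bar>f q - y\<bar> \<le> t"
        by (auto simp: dist_real_def abs_minus_commute)
      have "f (S (v k) a) \<in> cball y (C * rm ^ n)" if a: "\<bar>a\<bar> \<le> D" for a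
      proof -
        have "\<bar>S (v k) a - S (v k) 0\<bar> \<le> 1 * D"
          unfolding S_dist using a \<rho>_le_1[OF v] by (intro mult_mono) auto
        moreover have "S (v k) 0 \<in> {0..1}" using S_in_unit[OF v] by simp
        ultimately have "\<bar>S (v k) a - q\<bar> \<le> D + 1" using q by auto
        hence "\<bar>f (S (v k) a) - f q\<bar> \<le> t * (D + 1)"
          unfolding w(4) S_dist using w by (intro mult_mono) auto
        hence "\<bar>f (S (v k) a) - y\<bar> \<le> t * (D + 1) + t" using q by linarith
        also have "\<dots> \<le> t * (D + 3)" using t by (simp add: algebra_simps)
        also have "\<dots> \<le> C * rm ^ n"
        proof -
          have "C * (rm\<^sup>2 * t) \<le> C * rm ^ n" using n2 C0 by (intro mult_left_mono) auto
          thus ?thesis using rm_pos by (simp add: C_def mult.commute)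
        qed
        finally show ?thesis by (simp add: dist_real_def abs_minus_commute)
      qed
      from this[of x0] this[of "S [j] x0"]
      have "f (S (v k) x0) \<in> cball y (C * rm ^ n)"
           "f (S (v k) (S [j] x0)) \<in> cball y (C * rm ^ n)"
        by (auto simp: D_def)
      moreover have "f (S (v k) x0) = S (w @ v k) (S [] x0)"
        "f (S (v k) (S [j] x0)) = S (w @ v k) (S [j] x0)"
        by (simp_all add: w(4) word_map_append)
      ultimately show ?thesis unfolding Q_def using k by blast
    qed
    then obtain k where k: "\<And>f. f \<in> near t y \<Longrightarrow> k f \<le> K"
      "\<And>f. f \<in> near t y \<Longrightarrow> f (S (v (k f)) x0) \<in> Q []"
      "\<And>f. f \<in> near t y \<Longrightarrow> f (S (v (k f)) (S [j] x0)) \<in> Q [j]"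
      by metis
    \<comment> \<open>The number of appended zeros has to be recorded as well: the two base points depend on it.\<close>
    define F where "F f = (k f, f (S (v (k f)) x0), f (S (v (k f)) (S [j] x0)))" for f
    have inj: "inj_on F (near t y)"
    proof (rule inj_onI)
      fix f g assume fg: "f \<in> near t y" "g \<in> near t y" "F f = F g"
      define a b where "a = S (v (k f)) x0" and "b = S (v (k f)) (S [j] x0)"
      have ab: "a \<noteq> b" "f a = g a" "f b = g b"
        using fg(3) j(2) S_inj[OF v] by (auto simp: F_def a_def b_def sim_def)
      obtain w1 w2 where w: "f = S w1" "g = S w2"
        using fg by (auto simp: near_def maps_at_def)
      have "word_ratio r w1 * (a - b) = word_ratio r w2 * (a - b)"
        using ab by (simp add: w flip: word_map_diff[of r d _ a b])
      hence "word_ratio r w1 = word_ratio r w2" using ab by simp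
      moreover have "S w1 0 = S w2 0"
        using ab(2) calculation word_map_affine[of r d w1 a] word_map_affine[of r d w2 a]
        by (simp add: w)
      ultimately show "f = g"
        unfolding w by (intro ext) (metis word_map_affine)
    qed
    have sub: "F ` near t y \<subseteq> {..K} \<times> Q [] \<times> Q [j]"
      using k by (auto simp: F_def)
    have fin: "finite ({..K} \<times> Q [] \<times> Q [j])" using Q j by auto
    have "card (near t y) \<le> card ({..K} \<times> Q [] \<times> Q [j])"
      by (rule card_inj_on_le[OF inj sub fin])
    also have "\<dots> \<le> Suc K * (L * L)"
      using Q[of "[]"] Q[of "[j]"] j
      by (simp only: card_cartesian_product card_atMost) (intro mult_mono, auto)
    finally show ?thesis using inj_on_finite[OF inj sub fin] by blast
  qed
  thus ?thesis by blast
qed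

section \<open>Finitely many relative positions\<close>

lemma maps_atE:
  assumes "f \<in> maps_at t"
  obtains w where "w \<in> words m" "f = S w" "rm * t < \<rho> w" "\<rho> w \<le> t"
  using assms unfolding maps_at_def by blast

lemma maps_at_interval:
  assumes "f \<in> maps_at t"
  obtains a b where "f ` {0..1} = {a..b}" "a \<in> f ` {0, 1}" "b \<in> f ` {0, 1}"
    "rm * t < b - a" "b - a \<le> t" "0 \<le> a" "b \<le> 1"
proof -
  obtain w where w: "w \<in> words m" "f = S w" "rm * t < \<rho> w" "\<rho> w \<le> t"
    using assms by (rule maps_atE)
  define a b where "a = min (f 0) (f 1)" and "b = max (f 0) (f 1)"
  have wid: "b - a = \<rho> w" using S_dist[of w 1 0] by (auto simp: a_def b_def w(2))
  have img: "f ` {0..1} = {a..b}" unfolding a_def b_def w(2) by (rule word_image_interval)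
  have ends: "a \<in> f ` {0, 1}" "b \<in> f ` {0, 1}" by (auto simp: a_def b_def min_def max_def)
  have "f 0 \<in> {0..1}" "f 1 \<in> {0..1}" unfolding w(2) using S_in_unit[OF w(1)] by auto
  hence "0 \<le> a" "b \<le> 1" by (auto simp: a_def b_def)
  thus ?thesis by (intro that[OF img ends]) (use wid w in auto)
qed

text \<open>
  The numbers \<open>card (near t y)\<close> are bounded, hence maximal at some scale \<open>s\<close> and centre \<open>y\<close>. Composition
  with \<open>S w\<close> embeds that family into \<open>near (s * \<rho> w) (S w y)\<close>, which cannot be larger, so
  the embedding is onto. The point \<open>q\<close> serves to reach the copies: \<open>S w q\<close> lies in the image of
  the unit interval under \<open>S w\<close>, whereas \<open>y\<close> may lie outside the unit interval.
\<close>

lemma maximal_configuration: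
  assumes "weak_separation m r d"
  obtains s A q y where "0 < s" "s \<le> 1" "finite A" "q \<in> {0..1}" "\<bar>q - y\<bar> \<le> s"
    "\<forall>w\<in>words m. near (s * \<rho> w) (S w y) = (\<lambda>f. S w \<circ> f) ` A"
proof -
  obtain N where N: "\<And>t y. 0 < t \<Longrightarrow> t \<le> 1 \<Longrightarrow> finite (near t y) \<and> card (near t y) \<le> N"
    using card_near_bounded[OF assms] by blast
  let ?P = "\<lambda>k. \<exists>t y. 0 < t \<and> t \<le> 1 \<and> card (near t y) = k"
  define k where "k = (GREATEST k. ?P k)"
  have bound: "\<And>k. ?P k \<Longrightarrow> k \<le> N" using N by blast
  have "?P (card (near 1 0))" by (intro exI[of _ 1] exI[of _ 0]) simp
  hence "?P k" unfolding k_def using GreatestI_nat[of ?P] bound by blast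
  then obtain s y where sy: "0 < s" "s \<le> 1" "card (near s y) = k" by blast
  have max: "card (near t z) \<le> k" if "0 < t" "t \<le> 1" for t z
    unfolding k_def using Greatest_le_nat[of ?P "card (near t z)"] bound that by blast
  have "S [] \<in> maps_at 1" unfolding maps_at_def using rm_less_1 by (auto intro!: exI[of _ "[]"])
  moreover have "S [] 0 \<in> cball 0 1" by simp
  ultimately have "S [] \<in> near 1 0" unfolding near_def by force
  hence "card (near 1 0) \<noteq> 0" using N[of 1 0] by auto
  hence "near s y \<noteq> {}" using max[of 1 0] sy by auto
  then obtain f p where f: "f \<in> maps_at s" "p \<in> {0..1}" "f p \<in> cball y s"
    unfolding near_def by blast
  hence q: "f p \<in> {0..1}" "\<bar>f p - y\<bar> \<le> s"
    using S_in_unit by (auto elim!: maps_atE simp: dist_real_def abs_minus_commute)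
  have "near (s * \<rho> w) (S w y) = (\<lambda>f. S w \<circ> f) ` near s y" if w: "w \<in> words m" for w
  proof -
    have s': "0 < s * \<rho> w" "s * \<rho> w \<le> 1"
      using \<rho>_pos[OF w] \<rho>_le_1[OF w] sy by (auto intro: mult_le_one)
    have sub: "(\<lambda>f. S w \<circ> f) ` near s y \<subseteq> near (s * \<rho> w) (S w y)"
    proof clarify
      fix f assume "f \<in> near s y"
      then obtain p where f: "f \<in> maps_at s" "p \<in> {0..1}" "f p \<in> cball y s"
        unfolding near_def by blast
      obtain u where u: "u \<in> words m" "f = S u" "rm * s < \<rho> u" "\<rho> u \<le> s"
        using f(1) by (rule maps_atE)
      have eq: "S w \<circ> f = S (w @ u)" by (auto simp: u(2) word_map_append)
      have "S w \<circ> f \<in> maps_at (s * \<rho> w)"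
        unfolding maps_at_def eq using u w \<rho>_pos[OF w]
        by (auto intro!: exI[of _ "w @ u"] simp: abs_mult mult.assoc[symmetric]
            mult.commute[of _ "\<rho> w"])
      moreover have "\<bar>S w (f p) - S w y\<bar> \<le> s * \<rho> w"
        unfolding S_dist using f(3) \<rho>_pos[OF w]
        by (simp add: dist_real_def abs_minus_commute mult.commute)
      hence "(S w \<circ> f) p \<in> cball (S w y) (s * \<rho> w)"
        by (simp add: dist_real_def abs_minus_commute)
      ultimately show "S w \<circ> f \<in> near (s * \<rho> w) (S w y)"
        unfolding near_def using f(2) by blast
    qed
    have "inj_on (\<lambda>f. S w \<circ> f) (near s y)"
      using S_inj[OF w] by (intro inj_onI ext) (auto dest: fun_cong)
    hence "card ((\<lambda>f. S w \<circ> f) ` near s y) = k" using card_image sy(3) by blast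
    thus ?thesis
      using card_seteq[OF _ sub] N[OF s'] max[OF s'] by auto
  qed
  hence "\<forall>w\<in>words m. near (s * \<rho> w) (S w y) = (\<lambda>f. S w \<circ> f) ` near s y" by blast
  moreover have "finite (near s y)" using N sy by blast
  ultimately show ?thesis using that[OF sy(1,2) _ q] by blast
qed

definition overlap :: "real \<Rightarrow> (real \<Rightarrow> real) \<Rightarrow> (real \<Rightarrow> real) \<Rightarrow> bool" where
  "overlap \<eta> f g \<longleftrightarrow> (\<exists>c. cball c \<eta> \<subseteq> f ` {0..1} \<inter> g ` {0..1})"

text \<open>
  The images of \<open>g\<close> and \<open>h\<close> are both compared with that of \<open>f\<close>; they may be disjoint from each other.
\<close>

definition separates :: "real \<Rightarrow> real \<Rightarrow> bool" where
  "separates \<kappa> \<delta> \<longleftrightarrow> (\<forall>t>0. \<forall>f\<in>maps_at t. \<forall>g\<in>maps_at t. \<forall>h\<in>maps_at t.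
     overlap (\<kappa> * t) f g \<longrightarrow> overlap (\<kappa> * t) f h \<longrightarrow>
     (\<forall>e\<in>g ` {0, 1}. \<forall>e'\<in>h ` {0, 1}. e \<noteq> e' \<longrightarrow> \<delta> * t \<le> \<bar>e - e'\<bar>))"

text \<open>
  Inside the overlap of the two images there is room for a word \<open>u\<close> below \<open>f\<close>, with \<open>\<rho> u\<close> bounded
  below. At the corresponding copy of the maximal configuration all maps of the right scale are of
  the form \<open>f \<circ> S u \<circ> a\<close> with \<open>a\<close> in a fixed finite set \<open>A\<close>. As the image of \<open>g\<close> covers that place, a
  descendant \<open>g \<circ> S v\<close> of the right scale is among them, and \<open>\<rho> v\<close> is bounded below as well. Solving
  \<open>g \<circ> S v = f \<circ> S u \<circ> a\<close> for \<open>g\<close> leaves finitely many possibilities relative to \<open>f\<close>.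
\<close>

lemma finite_relative_endpoints:
  assumes wsc: "weak_separation m r d" and \<kappa>: "0 < \<kappa>"
  shows "\<exists>E. finite E \<and> (\<forall>t>0. \<forall>f\<in>maps_at t. \<forall>g\<in>maps_at t.
    overlap (\<kappa> * t) f g \<longrightarrow> g ` {0, 1} \<subseteq> f ` E)"
proof -
  obtain s A q y where s: "0 < s" "s \<le> 1" and A: "finite A"
    and q: "q \<in> {0..1}" "\<bar>q - y\<bar> \<le> s"
    and full: "\<forall>w\<in>words m. near (s * \<rho> w) (S w y) = (\<lambda>f. S w \<circ> f) ` A"
    by (rule maximal_configuration[OF wsc])
  define \<theta> where "\<theta> = min 1 (min \<kappa> rm)"
  have \<theta>: "0 < \<theta>" "\<theta> \<le> \<kappa>" "\<theta> \<le> rm" "\<theta> \<le> 1" using \<kappa> rm_pos by (auto simp: \<theta>_def)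
  define U where "U = {u \<in> words m. rm * \<theta> \<le> \<rho> u}"
  define V where "V = {v \<in> words m. rm * s * (rm * (rm * \<theta>)) \<le> \<rho> v}"
  \<comment> \<open>The innermost quotient is the preimage of the endpoint \<open>i\<close> under \<open>S v\<close>.\<close>
  define E where "E = (\<Union>u\<in>U. \<Union>a\<in>A. \<Union>v\<in>V. (\<lambda>i. S u (a ((i - S v 0) / word_ratio r v))) ` {0, 1})"
  have "finite U" "finite V"
    unfolding U_def V_def using rm_pos s \<theta> by (auto intro!: finite_words_bounded_ratio)
  hence "finite E" unfolding E_def using A by auto
  moreover have "g ` {0, 1} \<subseteq> f ` E"
    if t: "0 < t" and fg: "f \<in> maps_at t" "g \<in> maps_at t" and ov: "overlap (\<kappa> * t) f g" for t f g
  proof (rule image_subsetI)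
    fix i :: real assume i: "i \<in> {0, 1}"
    obtain c where c: "cball c (\<kappa> * t) \<subseteq> f ` {0..1} \<inter> g ` {0..1}"
      using ov unfolding overlap_def by blast
    obtain w0 where w0: "w0 \<in> words m" "f = S w0" "rm * t < \<rho> w0" "\<rho> w0 \<le> t"
      using fg(1) by (rule maps_atE)
    obtain w1 where w1: "w1 \<in> words m" "g = S w1" "rm * t < \<rho> w1" "\<rho> w1 \<le> t"
      using fg(2) by (rule maps_atE)
    have "c \<in> cball c (\<kappa> * t)" using \<kappa> t by simp
    then obtain z where z: "z \<in> {0..1}" "c = f z" using c by blast
    obtain u where u: "u \<in> words m" "z \<in> S u ` {0..1}" "rm * \<theta> < \<rho> u" "\<rho> u \<le> \<theta>"
      using ex_word_at_scale[OF \<theta>(1,4) z(1)] by blast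
    define w where "w = w0 @ u"
    have w: "w \<in> words m" "\<rho> w = \<rho> w0 * \<rho> u" "\<And>x. S w x = f (S u x)"
      using w0 u by (auto simp: w_def abs_mult word_map_append)
    obtain z' where z': "z' \<in> {0..1}" "z = S u z'" using u(2) by blast
    have "\<bar>S w q - c\<bar> = \<rho> w0 * (\<rho> u * \<bar>q - z'\<bar>)"
      by (simp only: w(3) z(2) w0(2) S_dist z'(2))
    also have "\<dots> \<le> t * (\<kappa> * 1)"
      using w0 u \<theta> q z' t by (intro mult_mono) (auto simp: mult_nonneg_nonneg)
    finally have "S w q \<in> cball c (\<kappa> * t)"
      by (simp add: dist_real_def abs_minus_commute mult.commute)
    then obtain z1 where z1: "z1 \<in> {0..1}" "S w q = g z1" using c by blast
    have pos: "0 < \<rho> w0" "0 < \<rho> w1" "0 < \<rho> u" "0 < \<rho> w" using \<rho>_pos w0 w1 u w by auto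
    \<comment> \<open>The ratio that \<open>v\<close> must have for \<open>w1 @ v\<close> to be of the same scale as the copy under \<open>S w\<close>.\<close>
    define s' where "s' = s * \<rho> w / \<rho> w1"
    have "s * \<rho> w \<le> 1 * (t * rm)" unfolding w(2)
      using s w0 u \<theta> pos by (intro mult_mono) auto
    hence "s * \<rho> w \<le> \<rho> w1" using w1 by (simp add: mult.commute)
    hence s': "0 < s'" "s' \<le> 1" using pos s by (auto simp: s'_def)
    obtain v where v: "v \<in> words m" "z1 \<in> S v ` {0..1}" "rm * s' < \<rho> v" "\<rho> v \<le> s'"
      using ex_word_at_scale[OF s' z1(1)] by blast
    have pv: "0 < \<rho> v" using \<rho>_pos v by blast
    have "rm * (s * \<rho> w) < \<rho> w1 * \<rho> v" "\<rho> w1 * \<rho> v \<le> s * \<rho> w"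
      using v pos by (simp_all add: s'_def field_simps)
    hence "S (w1 @ v) \<in> maps_at (s * \<rho> w)"
      unfolding maps_at_def using w1 v by (auto intro!: exI[of _ "w1 @ v"] simp: abs_mult)
    moreover have "S w q \<in> S (w1 @ v) ` {0..1}"
      using v(2) z1 by (auto simp: w1(2) word_map_append)
    moreover have "\<bar>S w q - S w y\<bar> \<le> s * \<rho> w"
      unfolding S_dist using q pos by (simp add: mult.commute)
    hence "S w q \<in> cball (S w y) (s * \<rho> w)" by (simp add: dist_real_def abs_minus_commute)
    ultimately have "S (w1 @ v) \<in> near (s * \<rho> w) (S w y)" unfolding near_def by blast
    then obtain a where a: "a \<in> A" "S (w1 @ v) = S w \<circ> a" using full[rule_format, OF w(1)] by blast
    have ga: "g (S v x) = f (S u (a x))" for x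
      using fun_cong[OF a(2), of x] by (simp add: w1(2) word_map_append w(3))
    have "u \<in> U" using u by (simp add: U_def)
    moreover have "v \<in> V"
    proof -
      have "rm * \<rho> w1 \<le> \<rho> w0" using w1 w0 rm_pos mult_left_mono[of "\<rho> w1" t rm] by linarith
      hence "(rm * \<rho> w1) * (rm * \<theta>) \<le> \<rho> w0 * \<rho> u"
        using u \<theta> rm_pos pos by (intro mult_mono) auto
      hence "s * (rm * (rm * \<theta>)) * \<rho> w1 \<le> s * \<rho> w" unfolding w(2)
        using s mult_left_mono[of _ _ s] by (simp add: mult_ac)
      hence "s * (rm * (rm * \<theta>)) \<le> s'" unfolding s'_def using pos by (simp add: pos_le_divide_eq)
      hence "rm * s * (rm * (rm * \<theta>)) \<le> rm * s'" using rm_pos by (simp add: mult.assoc)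
      thus ?thesis using v by (simp add: V_def)
    qed
    moreover have "S v ((i - S v 0) / word_ratio r v) = i"
      using pv by (subst word_map_affine) auto
    hence "g i = f (S u (a ((i - S v 0) / word_ratio r v)))" using ga by metis
    ultimately show "g i \<in> f ` E" unfolding E_def using a(1) i by blast
  qed
  ultimately show ?thesis by blast
qed

text \<open>
  Distinct points of the finite set of relative endpoints have a minimal distance, and \<open>f\<close>
  scales it by a factor above \<open>rm * t\<close>.
\<close>

lemma separated_endpoints:
  assumes wsc: "weak_separation m r d" and \<kappa>: "0 < \<kappa>"
  shows "\<exists>\<delta>>0. separates \<kappa> \<delta>"
proof -
  obtain E where E: "finite E"
    "\<forall>t>0. \<forall>f\<in>maps_at t. \<forall>g\<in>maps_at t. overlap (\<kappa> * t) f g \<longrightarrow> g ` {0, 1} \<subseteq> f ` E"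
    using finite_relative_endpoints[OF wsc \<kappa>] by blast
  define D where "D = (\<lambda>(a, b). \<bar>a - b\<bar>) ` {(a, b) \<in> E \<times> E. a \<noteq> b}"
  have D: "finite D" "\<And>x. x \<in> D \<Longrightarrow> 0 < x"
    unfolding D_def using E(1) by (auto intro: finite_subset[of _ "E \<times> E"])
  define \<delta> where "\<delta> = Min (insert 1 D)"
  have \<delta>: "0 < \<delta>" unfolding \<delta>_def using D by (subst Min_gr_iff) auto
  have "rm * \<delta> * t \<le> \<bar>e - e'\<bar>"
    if t: "t > 0" and f: "f \<in> maps_at t" and gh: "g \<in> maps_at t" "h \<in> maps_at t"
      and ov: "overlap (\<kappa> * t) f g" "overlap (\<kappa> * t) f h"
      and e: "e \<in> g ` {0, 1}" "e' \<in> h ` {0, 1}" and ne: "e \<noteq> e'" for t f g h e e'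
  proof -
    have "g ` {0, 1} \<subseteq> f ` E" "h ` {0, 1} \<subseteq> f ` E" using E(2) t f gh ov by blast+
    hence "e \<in> f ` E" "e' \<in> f ` E" using e by blast+
    then obtain a b where ab: "a \<in> E" "b \<in> E" "e = f a" "e' = f b" by blast
    hence "\<bar>a - b\<bar> \<in> D" using ne unfolding D_def by (intro image_eqI[of _ _ "(a, b)"]) auto
    hence "\<delta> \<le> \<bar>a - b\<bar>" unfolding \<delta>_def using D(1) by (intro Min_le) auto
    moreover obtain w where "f = S w" "rm * t < \<rho> w" using f by (rule maps_atE)
    ultimately have "(rm * t) * \<delta> \<le> \<rho> w * \<bar>a - b\<bar>"
      using \<delta> by (intro mult_mono) auto
    also have "\<dots> = \<bar>e - e'\<bar>" using ab \<open>f = S w\<close> by (simp only: S_dist)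
    finally show ?thesis by (simp add: mult_ac)
  qed
  hence "separates \<kappa> (rm * \<delta>)" unfolding separates_def by blast
  moreover have "0 < rm * \<delta>" using \<delta> rm_pos by simp
  ultimately show ?thesis by blast
qed

text \<open>
  Fix one image \<open>{a0..b0}\<close> of scale \<open>t\<close> that contains \<open>x\<close>. The ball is placed next to \<open>x\<close>, on its left
  or on its right; it does its job as soon as no image has its near endpoint between \<open>x\<close> and the
  far side of the ball.

  If \<open>x\<close> is very close to \<open>a0\<close>, the right side works. An image that starts just to the right of
  \<open>x\<close> overlaps \<open>{a0..b0}\<close> substantially, and its left endpoint is different from \<open>a0\<close>
  but too close to it. The case of \<open>b0\<close> is symmetric. If \<open>x\<close> is well inside \<open>{a0..b0}\<close>, every image with an
  endpoint near \<open>x\<close> overlaps \<open>{a0..b0}\<close> substantially, so there is at most one such endpoint,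
  and the side of \<open>x\<close> free of it works. The notion of closeness \<open>\<kappa>\<close> in the first two cases
  has to be fixed before the overlap \<open>\<kappa> / 4\<close> of the third.
\<close>

lemma ball_forcing_cover:
  assumes wsc: "weak_separation m r d"
  shows "\<exists>\<epsilon>>0. \<epsilon> \<le> 1 \<and> (\<forall>t x. 0 < t \<longrightarrow> t \<le> 1 \<longrightarrow> x \<in> {0..1} \<longrightarrow>
      (\<exists>y\<in>{0..1}. \<bar>y - x\<bar> \<le> t \<and>
        (\<forall>f\<in>maps_at t. f ` {0..1} \<inter> ball y (\<epsilon> * t) \<noteq> {} \<longrightarrow> x \<in> f ` {0..1})))"
proof -
  obtain \<delta>1 where \<delta>1: "0 < \<delta>1" and "separates (rm / 4) \<delta>1"
    using separated_endpoints[OF wsc, of "rm / 4"] rm_pos by auto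
  hence sep1: "\<And>t f g h e e'. \<lbrakk>0 < t; f \<in> maps_at t; g \<in> maps_at t; h \<in> maps_at t;
      overlap (rm / 4 * t) f g; overlap (rm / 4 * t) f h;
      e \<in> g ` {0, 1}; e' \<in> h ` {0, 1}; e \<noteq> e'\<rbrakk> \<Longrightarrow> \<delta>1 * t \<le> \<bar>e - e'\<bar>"
    unfolding separates_def by blast
  define \<kappa> where "\<kappa> = min (rm / 4) (\<delta>1 / 2)"
  have \<kappa>: "0 < \<kappa>" "\<kappa> \<le> rm / 4" "\<kappa> \<le> \<delta>1 / 2" using \<delta>1 rm_pos by (auto simp: \<kappa>_def)
  obtain \<delta>2 where \<delta>2: "0 < \<delta>2" and "separates (\<kappa> / 4) \<delta>2"
    using separated_endpoints[OF wsc, of "\<kappa> / 4"] \<kappa> by auto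
  hence sep2: "\<And>t f g h e e'. \<lbrakk>0 < t; f \<in> maps_at t; g \<in> maps_at t; h \<in> maps_at t;
      overlap (\<kappa> / 4 * t) f g; overlap (\<kappa> / 4 * t) f h;
      e \<in> g ` {0, 1}; e' \<in> h ` {0, 1}; e \<noteq> e'\<rbrakk> \<Longrightarrow> \<delta>2 * t \<le> \<bar>e - e'\<bar>"
    unfolding separates_def by blast
  define \<eta> where "\<eta> = min (\<kappa> / 2) (\<delta>2 / 2)"
  have \<eta>: "0 < \<eta>" "\<eta> \<le> \<kappa> / 2" "\<eta> \<le> \<delta>2 / 2" using \<delta>2 \<kappa> by (auto simp: \<eta>_def)
  have "\<exists>y\<in>{0..1}. \<bar>y - x\<bar> \<le> t \<and>
      (\<forall>f\<in>maps_at t. f ` {0..1} \<inter> ball y (\<eta> / 2 * t) \<noteq> {} \<longrightarrow> x \<in> f ` {0..1})"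
    if t: "0 < t" "t \<le> 1" and x: "x \<in> {0..1}" for t x
  proof -
    obtain w where "w \<in> words m" "x \<in> S w ` {0..1}" "rm * t < \<rho> w" "\<rho> w \<le> t"
      using ex_word_at_scale[OF t x] by blast
    hence f0: "S w \<in> maps_at t" "x \<in> S w ` {0..1}" by (auto simp: maps_at_def)
    define f where "f = S w"
    obtain a0 b0 where ab0: "f ` {0..1} = {a0..b0}" "a0 \<in> f ` {0, 1}" "b0 \<in> f ` {0, 1}"
      "rm * t < b0 - a0" "0 \<le> a0" "b0 \<le> 1"
      unfolding f_def using f0(1) by (rule maps_at_interval)
    have fm: "f \<in> maps_at t" and x0: "a0 \<le> x" "x \<le> b0"
      using f0 ab0(1) by (auto simp: f_def)
    have kt: "0 < \<kappa> * t" "\<kappa> * t \<le> rm * t / 4" "\<kappa> * t \<le> \<delta>1 * t / 2" "0 < \<eta> * t"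
      "\<eta> * t \<le> \<kappa> * t / 2" "\<eta> * t \<le> \<delta>2 * t / 2" "rm * t < t"
      using \<kappa> \<eta> t rm_less_1 mult_right_mono[OF \<kappa>(2), of t] mult_right_mono[OF \<kappa>(3), of t]
        mult_right_mono[OF \<eta>(2), of t] mult_right_mono[OF \<eta>(3), of t] by auto
    \<comment> \<open>The two ways to place the ball: centred at distance \<open>s / 2\<close> from \<open>x\<close>, where no image has its
      near endpoint within distance \<open>s\<close> of \<open>x\<close> on that side.\<close>
    have right: ?thesis
      if s: "\<eta> * t \<le> s" "s \<le> t" "x + s / 2 \<le> 1"
        and no: "\<And>g a b. \<lbrakk>g \<in> maps_at t; g ` {0..1} = {a..b}; a \<in> g ` {0, 1}; rm * t < b - a;
          x < a; a < x + s\<rbrakk> \<Longrightarrow> False" for s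
    proof (intro bexI[of _ "x + s / 2"] conjI ballI impI)
      fix g assume g: "g \<in> maps_at t" "g ` {0..1} \<inter> ball (x + s / 2) (\<eta> / 2 * t) \<noteq> {}"
      obtain a b where ab: "g ` {0..1} = {a..b}" "a \<in> g ` {0, 1}" "rm * t < b - a"
        using g(1) by (rule maps_at_interval)
      obtain p where "p \<in> {a..b}" "p \<in> ball (x + s / 2) (\<eta> / 2 * t)"
        using g(2) unfolding ab(1) by blast
      hence p: "a \<le> p" "p \<le> b" "\<bar>x + s / 2 - p\<bar> < \<eta> * t / 2" by (auto simp: dist_real_def)
      hence "x < p" "p < x + s" using s by linarith+
      hence "\<not> x < a" using no[OF g(1) ab] p by force
      thus "x \<in> g ` {0..1}" unfolding ab(1) using p \<open>x < p\<close> by simp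
    qed (use x s kt in auto)
    have left: ?thesis
      if s: "\<eta> * t \<le> s" "s \<le> t" "0 \<le> x - s / 2"
        and no: "\<And>g a b. \<lbrakk>g \<in> maps_at t; g ` {0..1} = {a..b}; b \<in> g ` {0, 1}; rm * t < b - a;
          x - s < b; b < x\<rbrakk> \<Longrightarrow> False" for s
    proof (intro bexI[of _ "x - s / 2"] conjI ballI impI)
      fix g assume g: "g \<in> maps_at t" "g ` {0..1} \<inter> ball (x - s / 2) (\<eta> / 2 * t) \<noteq> {}"
      obtain a b where ab: "g ` {0..1} = {a..b}" "b \<in> g ` {0, 1}" "rm * t < b - a"
        using g(1) by (rule maps_at_interval)
      obtain p where "p \<in> {a..b}" "p \<in> ball (x - s / 2) (\<eta> / 2 * t)"
        using g(2) unfolding ab(1) by blast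
      hence p: "a \<le> p" "p \<le> b" "\<bar>x - s / 2 - p\<bar> < \<eta> * t / 2" by (auto simp: dist_real_def)
      hence "x - s < p" "p < x" using s by linarith+
      hence "\<not> b < x" using no[OF g(1) ab] p by force
      thus "x \<in> g ` {0..1}" unfolding ab(1) using p \<open>p < x\<close> by simp
    qed (use x s kt in auto)
    consider (left_end) "x < a0 + \<kappa> * t" | (right_end) "b0 - \<kappa> * t < x"
      | (middle) "a0 + \<kappa> * t \<le> x" "x + \<kappa> * t \<le> b0" by linarith
    thus ?thesis
    proof cases
      case left_end
      show ?thesis
      proof (rule right[of "\<kappa> * t"])
        fix g a b assume g: "g \<in> maps_at t" "g ` {0..1} = {a..b}" "a \<in> g ` {0, 1}"
          "rm * t < b - a" "x < a" "a < x + \<kappa> * t"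
        have c: "cball (a + rm * t / 4) (rm / 4 * t) \<subseteq> f ` {0..1} \<inter> g ` {0..1}"
          unfolding ab0(1) g(2) cball_eq_atLeastAtMost
          using g left_end x0 ab0 kt by (auto simp: algebra_simps)
        hence "overlap (rm / 4 * t) f g" "overlap (rm / 4 * t) f f" unfolding overlap_def by blast+
        from sep1[OF t(1) fm fm g(1) this(2,1) ab0(2) g(3)]
        show False using g left_end x0 kt by auto
      qed (use kt x0 ab0 t left_end in linarith)+
    next
      case right_end
      show ?thesis
      proof (rule left[of "\<kappa> * t"])
        fix g a b assume g: "g \<in> maps_at t" "g ` {0..1} = {a..b}" "b \<in> g ` {0, 1}"
          "rm * t < b - a" "x - \<kappa> * t < b" "b < x"
        have c: "cball (b - rm * t / 4) (rm / 4 * t) \<subseteq> f ` {0..1} \<inter> g ` {0..1}"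
          unfolding ab0(1) g(2) cball_eq_atLeastAtMost
          using g right_end x0 ab0 kt by (auto simp: algebra_simps)
        hence "overlap (rm / 4 * t) f g" "overlap (rm / 4 * t) f f" unfolding overlap_def by blast+
        from sep1[OF t(1) fm fm g(1) this(2,1) ab0(3) g(3)]
        show False using g right_end x0 kt by auto
      qed (use kt x0 ab0 t right_end in linarith)+
    next
      case middle
      have ca: "overlap (\<kappa> / 4 * t) f g"
        if "g ` {0..1} = {a..b}" "rm * t < b - a" "x < a" "a < x + \<eta> * t" for g a b
        unfolding ab0(1) that(1) overlap_def cball_eq_atLeastAtMost
        using that middle kt
        by (intro exI[of _ "a + \<kappa> * t / 4"]) (auto simp: algebra_simps)
      have cb: "overlap (\<kappa> / 4 * t) f g"
        if "g ` {0..1} = {a..b}" "rm * t < b - a" "x - \<eta> * t < b" "b < x" for g a b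
        unfolding ab0(1) that(1) overlap_def cball_eq_atLeastAtMost
        using that middle kt
        by (intro exI[of _ "b - \<kappa> * t / 4"]) (auto simp: algebra_simps)
      show ?thesis
      proof (cases "\<exists>g a b. g \<in> maps_at t \<and> g ` {0..1} = {a..b} \<and> a \<in> g ` {0, 1} \<and>
          rm * t < b - a \<and> x < a \<and> a < x + \<eta> * t")
        case False
        show ?thesis
          by (rule right[of "\<eta> * t"]) (use False in blast | use kt x0 ab0 t middle in linarith)+
      next
        case True
        then obtain g a b where g: "g \<in> maps_at t" "g ` {0..1} = {a..b}" "a \<in> g ` {0, 1}"
          "rm * t < b - a" "x < a" "a < x + \<eta> * t" by blast
        show ?thesis
        proof (rule left[of "\<eta> * t"])
          fix h a' b' assume h: "h \<in> maps_at t" "h ` {0..1} = {a'..b'}" "b' \<in> h ` {0, 1}"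
            "rm * t < b' - a'" "x - \<eta> * t < b'" "b' < x"
          from sep2[OF t(1) fm g(1) h(1) ca[OF g(2,4,5,6)] cb[OF h(2,4,5,6)] g(3) h(3)]
          show False using g h kt by auto
        qed (use kt x0 ab0 t middle in linarith)+
      qed
    qed
  qed
  moreover have "\<eta> / 2 \<le> 1" "0 < \<eta> / 2" using \<eta> \<kappa> rm_less_1 by linarith+
  ultimately show ?thesis by blast
qed

end

section \<open>Self-similar measures supported by the unit interval\<close>

definition weight :: "(nat \<Rightarrow> real) \<Rightarrow> nat list \<Rightarrow> real" where
  "weight p w = prod_list (map p w)"

lemma weight_simps [simp]:
  "weight p [] = 1" "weight p (j # w) = p j * weight p w"
  "weight p (u @ v) = weight p u * weight p v"
  by (simp_all add: weight_def)

locale self_similar_interval =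
  fixes m :: nat and r d p :: "nat \<Rightarrow> real" and \<mu> :: "real measure"
  assumes ssm: "self_similar_measure m r d p \<mu>"
    and supp: "msupport \<mu> = {0..1}"
begin

lemma prob: "prob_space \<mu>" and sets_\<mu>: "sets \<mu> = sets borel"
  and p_pos: "j \<le> m \<Longrightarrow> 0 < p j" and p_sum: "(\<Sum>j\<le>m. p j) = 1"
  using ssm by (auto simp: self_similar_measure_def is_prob_vector_def)

lemma p_nonneg: "j \<le> m \<Longrightarrow> 0 \<le> p j"
  using p_pos less_imp_le by blast

lemma self_similarity:
  "E \<in> sets borel \<Longrightarrow> measure \<mu> E = (\<Sum>j\<le>m. p j * measure \<mu> (sim r d j -` E))"
  using ssm unfolding self_similar_measure_def by blast

lemma emeasure_\<mu>: "emeasure \<mu> E = ennreal (measure \<mu> E)"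
  using prob by (simp add: prob_space_def finite_measure.emeasure_eq_measure)

lemma measure_mono: "A \<subseteq> B \<Longrightarrow> B \<in> sets borel \<Longrightarrow> measure \<mu> A \<le> measure \<mu> B"
  using prob by (intro finite_measure.finite_measure_mono)
    (auto simp: sets_\<mu> prob_space_def)

lemma measure_le_1: "measure \<mu> A \<le> 1"
  using prob by (rule prob_space.prob_le_1)

text \<open>
  The complement of the support is a union of open null sets, and by the Lindelof property
  countably many of them suffice.
\<close>

lemma measure_off_support:
  assumes "E \<in> sets borel" "E \<inter> {0..1} = {}"
  shows "measure \<mu> E = 0"
proof -
  let ?F = "{U. open U \<and> emeasure \<mu> U = 0}"
  obtain F where F: "F \<subseteq> ?F" "countable F" "\<Union>F = \<Union>?F"
    using Lindelof[of ?F] by blast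
  have "E \<subseteq> \<Union>?F"
  proof
    fix x assume "x \<in> E"
    hence "x \<notin> msupport \<mu>" using assms(2) supp by blast
    thus "x \<in> \<Union>?F" unfolding msupport_def by (auto simp: not_gr_zero)
  qed
  hence sub: "E \<subseteq> (\<Union>U\<in>F. U)" using F(3) by simp
  have null: "(\<Union>U\<in>F. U) \<in> null_sets \<mu>"
    using F by (intro null_sets_UN') (auto simp: null_sets_def sets_\<mu>)
  hence "emeasure \<mu> E = 0"
    using emeasure_mono[OF sub, of \<mu>] by (auto simp: null_sets_def)
  thus ?thesis by (simp add: measure_def)
qed

lemma measure_support: "measure \<mu> {0..1} = 1"
proof -
  have sp: "space \<mu> = UNIV" using sets_eq_imp_space_eq[OF sets_\<mu>] by simp
  have "measure \<mu> (space \<mu> - {0..1}) = 1 - measure \<mu> {0..1}"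
    using prob by (intro prob_space.prob_compl) (auto simp: sets_\<mu>)
  moreover have "measure \<mu> (space \<mu> - {0..1}) = 0"
    by (rule measure_off_support) (auto simp: sp)
  ultimately show ?thesis by simp
qed

lemma sim_vimage_borel: "E \<in> sets borel \<Longrightarrow> sim r d j -` E \<in> sets borel"
proof -
  assume E: "E \<in> sets borel"
  have "sim r d j \<in> borel_measurable borel"
    unfolding sim_def by measurable
  from measurable_sets[OF this E] show ?thesis by simp
qed

lemma word_vimage_borel: "E \<in> sets borel \<Longrightarrow> word_map r d w -` E \<in> sets borel"
proof (induction w arbitrary: E)
  case (Cons j w)
  have "word_map r d (j # w) -` E = word_map r d w -` (sim r d j -` E)" by (auto simp: sim_def)
  thus ?case using Cons sim_vimage_borel by metis
qed (simp add: vimage_def)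

text \<open>
  One inclusion holds because a neighbourhood of \<open>sim r d j x\<close> has at least \<open>p j\<close> times the mass of a
  neighbourhood of \<open>x\<close>; the other because the complement of the closed union on the left
  is an open null set by self-similarity.
\<close>

lemma unit_interval_covered: "(\<Union>j\<le>m. sim r d j ` {0..1}) = {0..1}"
proof (intro equalityI subsetI)
  fix y assume "y \<in> (\<Union>j\<le>m. sim r d j ` {0..1})"
  then obtain j x where j: "j \<le> m" "x \<in> {0..1}" "y = sim r d j x" by blast
  have "0 < emeasure \<mu> U" if U: "open U" "y \<in> U" for U
  proof -
    have U': "open (sim r d j -` U)"
      unfolding sim_def using U(1) by (intro open_vimage) (auto intro!: continuous_intros)
    have "x \<in> msupport \<mu>" using j supp by simp
    hence "0 < emeasure \<mu> (sim r d j -` U)"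
      using U' U(2) j(3) unfolding msupport_def by auto
    hence "0 < p j * measure \<mu> (sim r d j -` U)" using p_pos[OF j(1)] by (simp add: emeasure_\<mu>)
    also have "\<dots> \<le> (\<Sum>j\<le>m. p j * measure \<mu> (sim r d j -` U))"
      using j(1) p_nonneg by (intro member_le_sum mult_nonneg_nonneg) auto
    also have "\<dots> = measure \<mu> U" using self_similarity U(1) by simp
    finally show ?thesis by (simp add: emeasure_\<mu>)
  qed
  hence "y \<in> msupport \<mu>" unfolding msupport_def by blast
  thus "y \<in> {0..1}" using supp by simp
next
  fix x :: real assume x: "x \<in> {0..1}"
  define K where "K = (\<Union>j\<le>m. sim r d j ` {0..1})"
  have "closed K"
    unfolding K_def sim_def
    by (intro closed_UN ballI compact_imp_closed compact_continuous_image continuous_intros) auto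
  hence o: "open (- K)" by auto
  show "x \<in> K"
  proof (rule ccontr)
    assume "x \<notin> K"
    hence "0 < emeasure \<mu> (- K)" using x supp o unfolding msupport_def by blast
    moreover have "measure \<mu> (- K) = (\<Sum>j\<le>m. p j * measure \<mu> (sim r d j -` (- K)))"
      using o by (intro self_similarity) auto
    moreover have "measure \<mu> (sim r d j -` (- K)) = 0" if "j \<le> m" for j
      using that o by (intro measure_off_support sim_vimage_borel) (auto simp: K_def)
    ultimately show False by (simp add: emeasure_\<mu>)
  qed
qed

sublocale interval_ifs m r d
  using ssm unit_interval_covered
  by unfold_locales (auto simp: self_similar_measure_def)

lemma weight_pos: "w \<in> words m \<Longrightarrow> 0 < weight p w"
  using p_pos by (induction w) auto

lemma measure_cylinder:
  assumes "w \<in> words m" "E \<in> sets borel"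
  shows "weight p w * measure \<mu> (S w -` E) \<le> measure \<mu> E"
  using assms
proof (induction w arbitrary: E)
  case Nil
  thus ?case by (simp add: vimage_def)
next
  case (Cons j w)
  have j: "j \<le> m" and w: "w \<in> words m" using Cons.prems by auto
  have E': "sim r d j -` E \<in> sets borel" using sim_vimage_borel Cons.prems by blast
  have eq: "S (j # w) -` E = S w -` (sim r d j -` E)" by (auto simp: sim_def)
  have "weight p (j # w) * measure \<mu> (S (j # w) -` E)
      = p j * (weight p w * measure \<mu> (S w -` (sim r d j -` E)))"
    by (simp only: eq weight_simps mult.assoc)
  also have "\<dots> \<le> p j * measure \<mu> (sim r d j -` E)"
    using Cons.IH[OF w E'] p_pos[OF j] by (intro mult_left_mono) auto
  also have "\<dots> \<le> (\<Sum>j\<le>m. p j * measure \<mu> (sim r d j -` E))"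
    using j p_nonneg by (intro member_le_sum mult_nonneg_nonneg) auto
  also have "\<dots> = measure \<mu> E" using self_similarity Cons.prems by simp
  finally show ?case .
qed

text \<open>
  Choose \<open>s\<close> with \<open>\<bar>r j\<bar> powr s \<le> p j\<close> for all letters. Then the weight of every word is at least
  \<open>\<rho> w powr s\<close>, and a ball contains a cylinder of comparable size.
\<close>

lemma measure_ball_lower_bound:
  "\<exists>c s. 0 < c \<and> 0 < s \<and> (\<forall>x\<in>{0..1}. \<forall>R. 0 < R \<longrightarrow> R \<le> 1 \<longrightarrow> c * R powr s \<le> measure \<mu> (ball x R))"
proof -
  \<comment> \<open>The summand \<open>1\<close> makes \<open>s\<close> positive.\<close>
  define s where "s = Max ((\<lambda>j. ln (p j) / ln \<bar>r j\<bar>) ` {..m}) + 1"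
  have s: "ln (p j) / ln \<bar>r j\<bar> \<le> s - 1" if "j \<le> m" for j
    unfolding s_def using that by simp
  have p1: "p j \<le> 1" if "j \<le> m" for j
  proof -
    have "p j \<le> (\<Sum>j\<le>m. p j)" using that p_pos by (intro member_le_sum) (auto intro: less_imp_le)
    thus ?thesis by (simp add: p_sum)
  qed
  have lnr: "ln \<bar>r j\<bar> < 0" if "j \<le> m" for j using r_bounds[OF that] by simp
  have "0 \<le> ln (p 0) / ln \<bar>r 0\<bar>"
    using p1[of 0] p_pos[of 0] lnr[of 0] by (intro divide_nonpos_nonpos) auto
  hence s0: "0 < s" using s[of 0] by simp
  have pj: "\<bar>r j\<bar> powr s \<le> p j" if j: "j \<le> m" for j
  proof -
    have "ln (p j) / ln \<bar>r j\<bar> \<le> s" using s[OF j] by simp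
    hence "s * ln \<bar>r j\<bar> \<le> ln (p j)" using lnr[OF j] by (simp add: neg_divide_le_eq)
    hence "exp (s * ln \<bar>r j\<bar>) \<le> exp (ln (p j))" by (subst exp_le_cancel_iff)
    thus ?thesis using r_bounds[OF j] p_pos[OF j] by (simp add: powr_def)
  qed
  have pw: "\<rho> w powr s \<le> weight p w" if "w \<in> words m" for w
    using that
  proof (induction w)
    case (Cons j w)
    have "\<rho> (j # w) powr s = \<bar>r j\<bar> powr s * \<rho> w powr s" by (simp add: abs_mult powr_mult)
    also have "\<dots> \<le> p j * weight p w"
      using Cons pj p_pos by (intro mult_mono) (auto intro: less_imp_le)
    finally show ?case by simp
  qed simp
  have "(rm / 2) powr s * R powr s \<le> measure \<mu> (ball x R)"
    if x: "x \<in> {0..1}" and R: "0 < R" "R \<le> 1" for x R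
  proof -
    obtain w where w: "w \<in> words m" "x \<in> S w ` {0..1}" "rm * (R / 2) < \<rho> w" "\<rho> w \<le> R / 2"
      using ex_word_at_scale[of "R / 2" x] x R by auto
    obtain z where z: "z \<in> {0..1}" "x = S w z" using w(2) by blast
    have "{0..1} \<subseteq> S w -` ball x R"
    proof
      fix u :: real assume u: "u \<in> {0..1}"
      have "\<bar>S w z - S w u\<bar> \<le> R / 2 * 1"
        unfolding S_dist using w z u by (intro mult_mono) auto
      thus "u \<in> S w -` ball x R" using R z by (simp add: dist_real_def)
    qed
    hence "1 \<le> measure \<mu> (S w -` ball x R)"
      using measure_mono[of "{0..1}" "S w -` ball x R"] word_vimage_borel measure_support by auto
    hence "weight p w * 1 \<le> weight p w * measure \<mu> (S w -` ball x R)"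
      using weight_pos[OF w(1)] by (intro mult_left_mono) auto
    also have "\<dots> \<le> measure \<mu> (ball x R)" using measure_cylinder[OF w(1)] by simp
    finally have "weight p w \<le> measure \<mu> (ball x R)" by simp
    moreover have "(rm * (R / 2)) powr s \<le> \<rho> w powr s"
      using w s0 rm_pos R by (intro powr_mono2) auto
    moreover have "(rm * (R / 2)) powr s = (rm / 2) powr s * R powr s"
      using rm_pos R by (simp add: powr_mult powr_divide)
    ultimately show ?thesis using pw[OF w(1)] by linarith
  qed
  moreover have "0 < (rm / 2) powr s" using rm_pos by simp
  ultimately show ?thesis using s0 by blast
qed

lemma measure_ball_pos:
  assumes "x \<in> {0..1}" "0 < R"
  shows "0 < measure \<mu> (ball x R)"
proof -
  have "x \<in> msupport \<mu>" using assms supp by simp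
  hence "0 < emeasure \<mu> (ball x R)" unfolding msupport_def using assms(2) by simp
  thus ?thesis by (simp add: emeasure_\<mu>)
qed

text \<open>
  Self-similarity is applied only to words whose ratio still exceeds \<open>rm ^ n\<close> (the words in
  \<open>live k\<close>); after \<open>k\<close> rounds the mass is distributed over the words that have stopped and those of
  length \<open>k\<close> that are alive. Eventually none is alive. For \<open>n = 0\<close> the set \<open>Lambda m r n\<close> is empty
  and the formula fails.
\<close>

lemma stopping_formula:
  assumes n: "0 < n" and E: "E \<in> sets borel"
  shows "finite (Lambda m r n)"
    and "measure \<mu> E = (\<Sum>w\<in>Lambda m r n. weight p w * measure \<mu> (S w -` E))"
proof -
  define T where "T = rm ^ n"
  have T: "0 < T" "T < 1"
    unfolding T_def using rm_pos rm_less_1 n by (auto simp: power_less_one_iff)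
  let ?L = "Lambda m r n"
  define live where "live k = {w \<in> words m. length w = k \<and> T < \<rho> w}" for k
  define stop where "stop k = {w \<in> ?L. length w \<le> k}" for k
  have fin_len: "finite {w \<in> words m. length w = k}" for k
    using finite_lists_length_eq[of "{..m}" k] by (simp add: words_def)
  have fin_live: "finite (live k)" for k
    unfolding live_def using fin_len[of k] by (auto elim: rev_finite_subset)
  define V where "V w = weight p w * measure \<mu> (S w -` E)" for w
  have butlast_live: "butlast w \<in> live (length w - 1)" if "w \<in> ?L" for w
    using that by (auto simp: Lambda_def live_def T_def words_def dest: in_set_butlastD)
  obtain k0 where k0: "\<And>k. k0 \<le> k \<Longrightarrow> live k = {}"
  proof -
    have f: "finite {w \<in> words m. T \<le> \<rho> w}" using T by (intro finite_words_bounded_ratio)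
    have "live k = {}" if k: "Suc (Max (length ` {w \<in> words m. T \<le> \<rho> w})) \<le> k" for k
    proof (rule ccontr)
      assume "live k \<noteq> {}"
      then obtain w where w: "w \<in> words m" "length w = k" "T < \<rho> w" by (auto simp: live_def)
      hence "length w \<le> Max (length ` {w \<in> words m. T \<le> \<rho> w})" using f by (intro Max_ge) auto
      thus False using k w by simp
    qed
    thus ?thesis by (rule that)
  qed
  have V_split: "V w = (\<Sum>j\<le>m. V (w @ [j]))" for w
  proof -
    have "V w = weight p w * (\<Sum>j\<le>m. p j * measure \<mu> (sim r d j -` (S w -` E)))"
      unfolding V_def using self_similarity[OF word_vimage_borel[OF E]] by simp
    also have "\<dots> = (\<Sum>j\<le>m. V (w @ [j]))"
      by (simp add: V_def sum_distrib_left mult.assoc vimage_def word_map_append sim_def)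
    finally show ?thesis .
  qed
  have step: "(\<Sum>w\<in>live k. V w) = (\<Sum>w\<in>{w \<in> ?L. length w = Suc k}. V w) + (\<Sum>w\<in>live (Suc k). V w)"
    for k
  proof -
    have inj: "inj_on (\<lambda>(w, j). w @ [j]) (live k \<times> {..m})" by (auto simp: inj_on_def)
    have img: "(\<lambda>(w, j). w @ [j]) ` (live k \<times> {..m}) = {w \<in> ?L. length w = Suc k} \<union> live (Suc k)"
    proof (intro equalityI subsetI)
      fix u assume "u \<in> (\<lambda>(w, j). w @ [j]) ` (live k \<times> {..m})"
      thus "u \<in> {w \<in> ?L. length w = Suc k} \<union> live (Suc k)"
        by (auto simp: live_def Lambda_def T_def not_le)
    next
      fix u assume u: "u \<in> {w \<in> ?L. length w = Suc k} \<union> live (Suc k)"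
      hence "u \<noteq> []" by (auto simp: live_def)
      then obtain w j where wj: "u = w @ [j]" by (cases u rule: rev_cases) auto
      have j: "j \<le> m" using u by (auto simp: wj live_def Lambda_def)
      have "w \<in> live k"
      proof (cases "u \<in> ?L")
        case True
        thus ?thesis using u butlast_live[OF True] by (auto simp: wj live_def)
      next
        case False
        hence w: "w \<in> words m" "length w = k" "T < \<rho> w * \<bar>r j\<bar>"
          using u by (auto simp: wj live_def abs_mult)
        have "\<rho> w * \<bar>r j\<bar> \<le> \<rho> w" using r_bounds[OF j] by (intro mult_left_le) auto
        thus ?thesis using w by (simp add: live_def)
      qed
      thus "u \<in> (\<lambda>(w, j). w @ [j]) ` (live k \<times> {..m})" using j wj by force
    qed
    have fin: "finite ({w \<in> ?L. length w = Suc k} \<union> live (Suc k))"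
      unfolding img[symmetric] using fin_live by auto
    have "(\<Sum>w\<in>live k. V w) = (\<Sum>(w, j)\<in>live k \<times> {..m}. V (w @ [j]))"
      by (subst V_split) (simp add: sum.cartesian_product)
    also have "\<dots> = (\<Sum>u\<in>(\<lambda>(w, j). w @ [j]) ` (live k \<times> {..m}). V u)"
      by (subst sum.reindex[OF inj]) (auto intro!: sum.cong)
    also have "\<dots> = (\<Sum>w\<in>{w \<in> ?L. length w = Suc k}. V w) + (\<Sum>w\<in>live (Suc k). V w)"
      unfolding img using fin by (intro sum.union_disjoint) (auto simp: live_def Lambda_def T_def)
    finally show ?thesis .
  qed
  have fin_stop: "finite (stop k)" for k
    using finite_lists_length_le[of "{..m}" k]
    by (rule rev_finite_subset) (auto simp: stop_def Lambda_def words_def)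
  have main: "measure \<mu> E = (\<Sum>w\<in>stop k. V w) + (\<Sum>w\<in>live k. V w)" for k
  proof (induction k)
    case 0
    have "live 0 = {[]}" "stop 0 = {}" using T by (auto simp: live_def stop_def Lambda_def)
    thus ?case by (simp add: V_def vimage_def)
  next
    case (Suc k)
    have "stop (Suc k) = stop k \<union> {w \<in> ?L. length w = Suc k}" by (auto simp: stop_def)
    moreover have "(\<Sum>w\<in>stop k \<union> {w \<in> ?L. length w = Suc k}. V w)
        = (\<Sum>w\<in>stop k. V w) + (\<Sum>w\<in>{w \<in> ?L. length w = Suc k}. V w)"
      using fin_stop[of k] fin_stop[of "Suc k"]
      by (intro sum.union_disjoint) (auto simp: stop_def elim: rev_finite_subset)
    ultimately show ?case using Suc step[of k] by simp
  qed
  have "?L = stop k0"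
  proof -
    have "length w \<le> k0" if "w \<in> ?L" for w
      using butlast_live[OF that] k0[of "length w - 1"] by (cases "k0 \<le> length w - 1") auto
    thus ?thesis by (auto simp: stop_def)
  qed
  thus "finite ?L" "measure \<mu> E = (\<Sum>w\<in>?L. weight p w * measure \<mu> (S w -` E))"
    using fin_stop[of k0] main[of k0] k0[of k0] by (auto simp: V_def)
qed

lemma Lambda_maps_at:
  assumes "w \<in> Lambda m r n"
  shows "S w \<in> maps_at (rm ^ n)"
proof -
  have w: "w \<in> words m" "w \<noteq> []" "\<rho> w \<le> rm ^ n" "rm ^ n < \<rho> (butlast w)"
    using assms by (auto simp: Lambda_def)
  obtain v j where v: "w = v @ [j]" using w(2) by (cases w rule: rev_cases) auto
  hence j: "j \<le> m" using w(1) by simp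
  have "rm * rm ^ n < \<bar>r j\<bar> * \<rho> v"
    using w(4) v rm_le[OF j] rm_pos by (intro mult_le_less_imp_less) auto
  hence "rm * rm ^ n < \<rho> w" by (simp add: v abs_mult mult.commute)
  thus ?thesis using w by (auto simp: maps_at_def)
qed

section \<open>From doubling to finite dimension and back\<close>

text \<open>
  The mass of a suitable ball of radius \<open>\<epsilon> * R\<close> near \<open>x\<close> is dominated by that of every smaller ball
  about \<open>x\<close>, up to a power of the quotient of the radii. The ball is the one of
  \<open>ball_forcing_cover\<close>: all maps that meet it cover \<open>x\<close>, in particular the one of largest
  total weight \<open>P f\<close>, which has at least the share \<open>1 / N\<close> of the mass.
\<close>

lemma ball_transfer:
  assumes wsc: "weak_separation m r d"
  shows "\<exists>\<epsilon> C s. 0 < \<epsilon> \<and> 0 < C \<and> 0 < s \<and> (\<forall>R x. 0 < R \<longrightarrow> R < 1 \<longrightarrow> x \<in> {0..1} \<longrightarrow>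
    (\<exists>y\<in>{0..1}. \<bar>y - x\<bar> \<le> R \<and> (\<forall>\<eta>. 0 < \<eta> \<longrightarrow> \<eta> \<le> R \<longrightarrow>
      measure \<mu> (ball y (\<epsilon> * R)) * (\<eta> / R) powr s \<le> C * measure \<mu> (ball x \<eta>))))"
proof -
  obtain N where N: "\<And>t y. 0 < t \<Longrightarrow> t \<le> 1 \<Longrightarrow> finite (near t y) \<and> card (near t y) \<le> N"
    using card_near_bounded[OF wsc] by blast
  obtain \<epsilon> where \<epsilon>: "0 < \<epsilon>" "\<epsilon> \<le> 1"
    and forcing: "\<forall>t x. 0 < t \<longrightarrow> t \<le> 1 \<longrightarrow> x \<in> {0..1} \<longrightarrow>
      (\<exists>y\<in>{0..1}. \<bar>y - x\<bar> \<le> t \<and>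
        (\<forall>f\<in>maps_at t. f ` {0..1} \<inter> ball y (\<epsilon> * t) \<noteq> {} \<longrightarrow> x \<in> f ` {0..1}))"
    using ball_forcing_cover[OF wsc] by blast
  obtain c s where c: "0 < c" "0 < s"
    and lower: "\<And>x R. x \<in> {0..1} \<Longrightarrow> 0 < R \<Longrightarrow> R \<le> 1 \<Longrightarrow> c * R powr s \<le> measure \<mu> (ball x R)"
    using measure_ball_lower_bound by blast
  define C where "C = (real N + 1) / c"
  have "\<exists>y\<in>{0..1}. \<bar>y - x\<bar> \<le> R \<and> (\<forall>\<eta>. 0 < \<eta> \<longrightarrow> \<eta> \<le> R \<longrightarrow>
      measure \<mu> (ball y (rm * \<epsilon> * R)) * (\<eta> / R) powr s \<le> C * measure \<mu> (ball x \<eta>))"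
    if R: "0 < R" "R < 1" and x: "x \<in> {0..1}" for R x
  proof -
    define n where "n = (LEAST n. rm ^ n \<le> R)"
    define t where "t = rm ^ n"
    have ex: "\<exists>n. rm ^ n \<le> R"
      using real_arch_pow_inv[of R rm] rm_pos rm_less_1 R by (auto intro: less_imp_le)
    have t1: "t \<le> R" unfolding t_def n_def using LeastI_ex[OF ex] .
    have n: "0 < n" using t1 R by (cases n) (auto simp: t_def)
    then obtain i where i: "n = Suc i" by (cases n) auto
    hence "\<not> rm ^ i \<le> R" unfolding n_def using not_less_Least by (metis lessI)
    hence t2: "rm * R \<le> t" using rm_pos by (simp add: t_def i)
    have t0: "0 < t" "t \<le> 1" using rm_pos t1 R by (auto simp: t_def)
    obtain y where y: "y \<in> {0..1}" "\<bar>y - x\<bar> \<le> t"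
      and force: "\<forall>f\<in>maps_at t. f ` {0..1} \<inter> ball y (\<epsilon> * t) \<noteq> {} \<longrightarrow> x \<in> f ` {0..1}"
      using forcing[rule_format, OF t0 x] by blast
    define B where "B = ball y (\<epsilon> * t)"
    have B: "B \<in> sets borel" by (simp add: B_def)
    let ?L = "Lambda m r n"
    have fin: "finite ?L" using stopping_formula(1)[OF n B] .
    define H where "H = {w \<in> ?L. S w ` {0..1} \<inter> B \<noteq> {}}"
    have H: "finite H" "H \<subseteq> ?L" using fin by (auto simp: H_def)
    have wp: "0 < weight p w" if "w \<in> ?L" for w
      using that by (intro weight_pos) (auto simp: Lambda_def)
    define P where "P f = (\<Sum>w\<in>{w \<in> H. S w = f}. weight p w)" for f
    have "measure \<mu> B = (\<Sum>w\<in>?L. weight p w * measure \<mu> (S w -` B))"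
      using stopping_formula(2)[OF n B] .
    also have "\<dots> = (\<Sum>w\<in>H. weight p w * measure \<mu> (S w -` B))"
    proof (rule sum.mono_neutral_right[OF fin H(2)], rule ballI)
      fix w assume "w \<in> ?L - H"
      hence "S w -` B \<inter> {0..1} = {}" by (auto simp: H_def)
      thus "weight p w * measure \<mu> (S w -` B) = 0"
        using measure_off_support[OF word_vimage_borel[OF B]] by simp
    qed
    also have "\<dots> \<le> (\<Sum>w\<in>H. weight p w)"
      using wp H(2) measure_le_1 by (intro sum_mono mult_left_le) (auto intro: less_imp_le)
    also have "\<dots> = (\<Sum>f\<in>S ` H. P f)"
      unfolding P_def by (rule sum.image_gen[OF H(1)])
    finally have BP: "measure \<mu> B \<le> (\<Sum>f\<in>S ` H. P f)" .
    have "0 < measure \<mu> B" unfolding B_def using y \<epsilon> t0 by (intro measure_ball_pos) auto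
    hence "S ` H \<noteq> {}" using BP by auto
    moreover have finSH: "finite (S ` H)" using H(1) by simp
    ultimately have "Max (P ` S ` H) \<in> P ` S ` H" by (intro Max_in) auto
    then obtain f where f: "f \<in> S ` H" "P f = Max (P ` S ` H)" by force
    have "\<epsilon> * t \<le> t" using \<epsilon> t0 by simp
    hence sub: "S ` H \<subseteq> near t y"
      using H(2) Lambda_maps_at unfolding H_def B_def near_def t_def by fastforce
    have "measure \<mu> B \<le> (\<Sum>f\<in>S ` H. P f)" by (rule BP)
    also have "\<dots> \<le> of_nat (card (S ` H)) * P f"
      unfolding f(2) using finSH by (intro sum_bounded_above Max_ge) auto
    also have "\<dots> \<le> (real N + 1) * P f"
    proof (intro mult_right_mono)
      show "0 \<le> P f" unfolding P_def using wp H(2) by (intro sum_nonneg) (auto intro: less_imp_le)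
      have "card (S ` H) \<le> card (near t y)" using N[OF t0] sub by (intro card_mono) auto
      also have "\<dots> \<le> N" using N[OF t0] by blast
      finally show "real (card (S ` H)) \<le> real N + 1" by simp
    qed
    finally have BPf: "measure \<mu> B \<le> (real N + 1) * P f" .
    have fm: "f \<in> maps_at t" "f ` {0..1} \<inter> ball y (\<epsilon> * t) \<noteq> {}"
      using f(1) Lambda_maps_at unfolding H_def B_def t_def by auto
    obtain z where z: "z \<in> {0..1}" "x = f z" using force[rule_format, OF fm] by blast
    have small: "P f * (c * (\<eta> / t) powr s) \<le> measure \<mu> (ball x \<eta>)" if \<eta>: "0 < \<eta>" "\<eta> \<le> t" for \<eta>
    proof -
      obtain w0 where w0: "f = S w0" "\<bar>word_ratio r w0\<bar> \<le> t"
        using fm(1) by (rule maps_atE)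
      have "ball z (\<eta> / t) \<subseteq> f -` ball x \<eta>"
      proof
        fix u assume "u \<in> ball z (\<eta> / t)"
        hence u: "\<bar>z - u\<bar> < \<eta> / t" by (simp add: dist_real_def)
        have "\<bar>f z - f u\<bar> \<le> t * \<bar>z - u\<bar>"
          unfolding w0(1) S_dist using w0(2) by (intro mult_right_mono) auto
        also have "\<dots> < \<eta>" using u t0 by (simp add: field_simps)
        finally show "u \<in> f -` ball x \<eta>" using z by (simp add: dist_real_def)
      qed
      hence "measure \<mu> (ball z (\<eta> / t)) \<le> measure \<mu> (f -` ball x \<eta>)"
        unfolding w0(1) by (intro measure_mono word_vimage_borel) auto
      moreover have "c * (\<eta> / t) powr s \<le> measure \<mu> (ball z (\<eta> / t))"
        using z \<eta> t0 by (intro lower) auto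
      ultimately have lb: "c * (\<eta> / t) powr s \<le> measure \<mu> (f -` ball x \<eta>)" by linarith
      have "P f * (c * (\<eta> / t) powr s) = (\<Sum>w\<in>{w \<in> H. S w = f}. weight p w * (c * (\<eta> / t) powr s))"
        unfolding P_def by (rule sum_distrib_right)
      also have "\<dots> \<le> (\<Sum>w\<in>{w \<in> H. S w = f}. weight p w * measure \<mu> (S w -` ball x \<eta>))"
      proof (intro sum_mono mult_left_mono)
        fix w assume w: "w \<in> {w \<in> H. S w = f}"
        show "c * (\<eta> / t) powr s \<le> measure \<mu> (S w -` ball x \<eta>)" using lb w by simp
        show "0 \<le> weight p w" using wp[of w] w H(2) by auto
      qed
      also have "\<dots> \<le> (\<Sum>w\<in>?L. weight p w * measure \<mu> (S w -` ball x \<eta>))"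
      proof (rule sum_mono2[OF fin])
        show "{w \<in> H. S w = f} \<subseteq> ?L" using H(2) by blast
        show "0 \<le> weight p w * measure \<mu> (S w -` ball x \<eta>)" if "w \<in> ?L - {w \<in> H. S w = f}" for w
          using wp[of w] that by simp
      qed
      also have "\<dots> = measure \<mu> (ball x \<eta>)"
        using stopping_formula(2)[OF n, of "ball x \<eta>"] by simp
      finally show ?thesis .
    qed
    have "measure \<mu> (ball y (rm * \<epsilon> * R)) * (\<eta> / R) powr s \<le> C * measure \<mu> (ball x \<eta>)"
      if \<eta>: "0 < \<eta>" "\<eta> \<le> R" for \<eta>
    proof -
      \<comment> \<open>The scale \<open>t\<close> may be smaller than \<open>R\<close>; radii between \<open>t\<close> and \<open>R\<close> are replaced by \<open>t\<close>.\<close>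
      define \<eta>' where "\<eta>' = min \<eta> t"
      have \<eta>': "0 < \<eta>'" "\<eta>' \<le> t" "\<eta>' \<le> \<eta>" using \<eta> t0 by (auto simp: \<eta>'_def)
      have "\<eta> / R \<le> \<eta>' / t"
        using \<eta> t0 t1 R by (auto simp: \<eta>'_def min_def field_simps)
      hence pw: "(\<eta> / R) powr s \<le> (\<eta>' / t) powr s" using \<eta> R c by (intro powr_mono2) auto
      have "rm * \<epsilon> * R \<le> \<epsilon> * t" using t2 \<epsilon> by (simp add: mult.assoc mult.left_commute)
      hence "measure \<mu> (ball y (rm * \<epsilon> * R)) \<le> measure \<mu> B"
        unfolding B_def by (intro measure_mono) auto
      hence "measure \<mu> (ball y (rm * \<epsilon> * R)) \<le> (real N + 1) * P f" using BPf by linarith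
      hence "measure \<mu> (ball y (rm * \<epsilon> * R)) * (\<eta> / R) powr s
          \<le> ((real N + 1) * P f) * (\<eta>' / t) powr s"
        using pw by (intro mult_mono) (auto intro: order_trans[OF measure_nonneg])
      also have "\<dots> = C * (P f * (c * (\<eta>' / t) powr s))" using c by (simp add: C_def)
      also have "\<dots> \<le> C * measure \<mu> (ball x \<eta>')"
        using small[OF \<eta>'(1,2)] c by (intro mult_left_mono) (auto simp: C_def)
      also have "\<dots> \<le> C * measure \<mu> (ball x \<eta>)"
        using \<eta>'(3) c by (intro mult_left_mono measure_mono) (auto simp: C_def)
      finally show ?thesis .
    qed
    moreover have "\<bar>y - x\<bar> \<le> R" using y t1 by linarith
    ultimately show ?thesis using y(1) by blast
  qed
  moreover have "0 < rm * \<epsilon>" "0 < C" using rm_pos \<epsilon> c by (auto simp: C_def)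
  ultimately show ?thesis using c(2) by blast
qed

text \<open>
  For \<open>R \<le> C1\<close> the radius \<open>R powr (1 + \<Phi> R) / 2\<close> is compared with \<open>R\<close>. The radii above \<open>C1\<close> are
  absorbed into the constant, as balls of radius at least \<open>C1 / 2\<close> have mass bounded below.
\<close>

lemma Phi_doubling_if_finite_dim:
  assumes \<Phi>: "dimension_function \<Phi>" and fin: "upper_Phi_dim \<Phi> \<mu> < \<infinity>"
  shows "Phi_doubling \<Phi> \<mu>"
proof -
  obtain \<alpha> C1 C2 where C: "0 < C1" "0 < C2"
    and dim: "\<forall>\<eta> R. 0 < \<eta> \<and> \<eta> < R powr (1 + \<Phi> R) \<and> R powr (1 + \<Phi> R) \<le> R \<and> R \<le> C1 \<and> 0 < R \<and> R < 1 \<longrightarrow>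
      (\<forall>x\<in>msupport \<mu>. measure \<mu> (ball x R) / measure \<mu> (ball x \<eta>) \<le> C2 * (R / \<eta>) powr \<alpha>)"
    using fin unfolding upper_Phi_dim_def Inf_less_iff by blast
  obtain c s where c: "0 < c" "0 < s"
    and lower: "\<forall>x\<in>{0..1}. \<forall>R. 0 < R \<longrightarrow> R \<le> 1 \<longrightarrow> c * R powr s \<le> measure \<mu> (ball x R)"
    using measure_ball_lower_bound by blast
  define \<gamma> where "\<gamma> = max \<alpha> 1"
  define b where "b = c * (C1 / 2) powr s"
  have b: "0 < b" using c C by (simp add: b_def)
  define K where "K = 1 + C2 * 2 powr \<gamma> + 1 / b"
  have "0 \<le> C2 * 2 powr \<gamma>" "0 < 1 / b" using C b by auto
  hence K: "1 \<le> K" "C2 * 2 powr \<gamma> \<le> K" "1 / b \<le> K" by (auto simp: K_def)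
  have "measure \<mu> (ball x R) \<le> K * R powr (- \<gamma> * \<Phi> R) * measure \<mu> (ball x (R / 2))"
    if x: "x \<in> {0..1}" and R: "0 < R" "R < 1" for x R
  proof -
    have \<Phi>0: "0 \<le> \<Phi> R" using \<Phi> R by (auto simp: dimension_function_def)
    define M where "M = measure \<mu> (ball x (R / 2))"
    have M0: "0 < M" unfolding M_def using measure_ball_pos x R by simp
    have small: "R powr \<Phi> R \<le> 1" using R \<Phi>0 by (intro powr_le1) auto
    show ?thesis
    proof (cases "R \<le> C1")
      case True
      define \<eta> where "\<eta> = R powr (1 + \<Phi> R) / 2"
      have eq: "R powr (1 + \<Phi> R) = R * R powr \<Phi> R" using R by (simp add: powr_add)
      have \<eta>: "0 < \<eta>" "\<eta> < R powr (1 + \<Phi> R)" using R by (auto simp: \<eta>_def)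
      have le: "R powr (1 + \<Phi> R) \<le> R" unfolding eq using small R by (intro mult_left_le) auto
      have ratio: "R / \<eta> = 2 * R powr (- \<Phi> R)"
        unfolding \<eta>_def eq using R by (simp add: powr_minus field_simps)
      have "1 \<le> R / \<eta>" using \<eta> le by simp
      hence "(R / \<eta>) powr \<alpha> \<le> (R / \<eta>) powr \<gamma>" by (intro powr_mono) (auto simp: \<gamma>_def)
      also have "\<dots> = 2 powr \<gamma> * R powr (- \<gamma> * \<Phi> R)"
        unfolding ratio by (simp add: powr_mult powr_powr mult.commute)
      finally have pw: "(R / \<eta>) powr \<alpha> \<le> 2 powr \<gamma> * R powr (- \<gamma> * \<Phi> R)" .
      have pos: "0 < measure \<mu> (ball x \<eta>)" using measure_ball_pos x \<eta> by blast
      have "measure \<mu> (ball x R) / measure \<mu> (ball x \<eta>) \<le> C2 * (R / \<eta>) powr \<alpha>"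
        using dim \<eta> le True R x supp by blast
      hence "measure \<mu> (ball x R) \<le> C2 * (R / \<eta>) powr \<alpha> * measure \<mu> (ball x \<eta>)"
        using pos by (simp add: pos_divide_le_eq)
      also have "\<dots> \<le> C2 * (2 powr \<gamma> * R powr (- \<gamma> * \<Phi> R)) * M"
        unfolding M_def using pw C \<eta> le
        by (intro mult_mono mult_left_mono measure_mono subset_ball mult_nonneg_nonneg) (auto simp: \<eta>_def)
      also have "\<dots> = (C2 * 2 powr \<gamma>) * R powr (- \<gamma> * \<Phi> R) * M" by simp
      also have "\<dots> \<le> K * R powr (- \<gamma> * \<Phi> R) * M"
        using K M0 by (intro mult_right_mono) auto
      finally show ?thesis by (simp add: M_def)
    next
      case False
      have "b \<le> c * (R / 2) powr s"
        unfolding b_def using False c C by (intro mult_left_mono powr_mono2) auto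
      also have "\<dots> \<le> M" unfolding M_def using lower x R by simp
      finally have "b \<le> M" .
      hence "1 \<le> 1 / b * 1 * M" using b by (simp add: field_simps)
      also have "\<dots> \<le> K * R powr (- \<gamma> * \<Phi> R) * M"
      proof (intro mult_mono K)
        have "R powr 0 \<le> R powr (- \<gamma> * \<Phi> R)"
          using R \<Phi>0 by (intro powr_mono') (auto simp: \<gamma>_def max_def mult_nonneg_nonneg)
        thus "1 \<le> R powr (- \<gamma> * \<Phi> R)" using R by simp
      qed (use K M0 b in auto)
      finally show ?thesis using measure_le_1[of "ball x R"] by (simp add: M_def)
    qed
  qed
  moreover have "0 < \<gamma>" by (simp add: \<gamma>_def)
  ultimately show ?thesis unfolding Phi_doubling_def supp using K(1) by blast
qed

text \<open>
  For a fixed number \<open>k\<close> of halvings the radii stay comparable to \<open>R\<close>. As \<open>\<Phi>\<close> is increasing and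
  doubling, its values there are at most a multiple of \<open>\<Phi> R\<close>, so every halving costs
  a fixed power of \<open>R powr (- \<Phi> R)\<close>. Replacing \<open>R / 2 ^ k\<close> by \<open>R\<close> as the base of that power costs only a
  constant, because \<open>\<Phi> R \<le> \<Phi> (1 / 2)\<close>.
\<close>

lemma iterated_Phi_doubling:
  assumes \<Phi>: "dimension_function \<Phi>" and mono: "mono_on {0<..<1} \<Phi>"
    and dbl: "doubling_function \<Phi>" and \<mu>: "Phi_doubling \<Phi> \<mu>"
  shows "\<exists>D \<beta>. 0 < D \<and> 0 < \<beta> \<and> (\<forall>y\<in>{0..1}. \<forall>R. 0 < R \<longrightarrow> R \<le> 1 / 4 \<longrightarrow>
    measure \<mu> (ball y (2 * R)) \<le> D * R powr (- \<beta> * \<Phi> R) * measure \<mu> (ball y (2 * R / 2 ^ k)))"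
proof -
  obtain C \<gamma> where C: "1 \<le> C" "0 < \<gamma>"
    and dm: "\<And>x R. x \<in> {0..1} \<Longrightarrow> 0 < R \<Longrightarrow> R < 1 \<Longrightarrow>
      measure \<mu> (ball x R) \<le> C * R powr (- \<gamma> * \<Phi> R) * measure \<mu> (ball x (R / 2))"
    using \<mu> unfolding Phi_doubling_def supp by blast
  obtain c where c: "0 < c" "\<And>x. x \<in> {0<..<1} \<Longrightarrow> \<Phi> x \<le> c * \<Phi> (x / 2)"
    using dbl unfolding doubling_function_def by blast
  define \<beta> where "\<beta> = \<gamma> * c"
  have \<beta>: "0 < \<beta>" using C c by (simp add: \<beta>_def)
  define D where "D = C * (2 ^ k) powr (\<beta> * \<Phi> (1 / 2))"
  have D: "0 < D" using C by (simp add: D_def)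
  have iter: "measure \<mu> (ball y (2 * R)) \<le> (D * R powr (- \<beta> * \<Phi> R)) ^ i * measure \<mu> (ball y (2 * R / 2 ^ i))"
    if y: "y \<in> {0..1}" and R: "0 < R" "R \<le> 1 / 4" and i: "i \<le> k" for y R i
    using i
  proof (induction i)
    case (Suc i)
    define u where "u = 2 * R / 2 ^ i"
    have \<Phi>0: "0 \<le> \<Phi> x" if "x \<in> {0<..<1}" for x using \<Phi> that by (auto simp: dimension_function_def)
    have "2 * R / 2 ^ i \<le> 2 * R / 1" using R by (intro divide_left_mono) auto
    hence "u \<le> 2 * R" by (simp add: u_def)
    moreover have "0 < u" using R by (simp add: u_def)
    ultimately have u: "0 < u" "u \<le> 2 * R" "u < 1" using R by linarith+
    have "(2::real) ^ i \<le> 2 ^ k" using Suc.prems by (intro power_increasing) auto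
    hence "R / 2 ^ k \<le> 2 * R / 2 ^ i" using R by (intro frac_le) auto
    hence uk: "R / 2 ^ k \<le> u" by (simp add: u_def)
    have "\<Phi> u \<le> \<Phi> (2 * R)" using mono u R by (auto simp: mono_on_def)
    also have "\<dots> \<le> c * \<Phi> R" using c(2)[of "2 * R"] R by simp
    finally have "\<gamma> * \<Phi> u \<le> \<gamma> * (c * \<Phi> R)" using C by (intro mult_left_mono) auto
    hence "u powr (- \<gamma> * \<Phi> u) \<le> u powr (- \<beta> * \<Phi> R)"
      using u by (intro powr_mono') (auto simp: \<beta>_def)
    also have "\<dots> \<le> (R / 2 ^ k) powr (- \<beta> * \<Phi> R)"
      using uk R \<beta> \<Phi>0[of R] by (intro powr_mono2') (auto simp: mult_nonneg_nonneg)
    also have "\<dots> = (2 ^ k) powr (\<beta> * \<Phi> R) * R powr (- \<beta> * \<Phi> R)"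
      using R by (simp add: powr_divide powr_minus field_simps)
    also have "\<dots> \<le> (2 ^ k) powr (\<beta> * \<Phi> (1 / 2)) * R powr (- \<beta> * \<Phi> R)"
    proof (intro mult_right_mono powr_mono mult_left_mono)
      show "\<Phi> R \<le> \<Phi> (1 / 2)" using mono R by (auto simp: mono_on_def)
    qed (use \<beta> in auto)
    finally have "C * u powr (- \<gamma> * \<Phi> u) \<le> D * R powr (- \<beta> * \<Phi> R)"
      unfolding D_def mult.assoc using C by (intro mult_left_mono) auto
    hence "C * u powr (- \<gamma> * \<Phi> u) * measure \<mu> (ball y (u / 2))
        \<le> D * R powr (- \<beta> * \<Phi> R) * measure \<mu> (ball y (u / 2))"
      by (intro mult_right_mono) auto
    hence step: "measure \<mu> (ball y u) \<le> D * R powr (- \<beta> * \<Phi> R) * measure \<mu> (ball y (u / 2))"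
      using dm[OF y u(1) u(3)] by linarith
    have "measure \<mu> (ball y (2 * R)) \<le> (D * R powr (- \<beta> * \<Phi> R)) ^ i * measure \<mu> (ball y u)"
      unfolding u_def using Suc by simp
    also have "\<dots> \<le> (D * R powr (- \<beta> * \<Phi> R)) ^ i *
        (D * R powr (- \<beta> * \<Phi> R) * measure \<mu> (ball y (u / 2)))"
      using step D by (intro mult_left_mono) auto
    also have "\<dots> = (D * R powr (- \<beta> * \<Phi> R)) ^ Suc i * measure \<mu> (ball y (2 * R / 2 ^ Suc i))"
      by (simp add: u_def mult_ac)
    finally show ?case .
  qed simp
  \<comment> \<open>The factor \<open>k + 1\<close> instead of \<open>k\<close> keeps the exponent positive for \<open>k = 0\<close>.\<close>
  have "measure \<mu> (ball y (2 * R))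
      \<le> D ^ k * R powr (- (\<beta> * (k + 1)) * \<Phi> R) * measure \<mu> (ball y (2 * R / 2 ^ k))"
    if y: "y \<in> {0..1}" and R: "0 < R" "R \<le> 1 / 4" for y R
  proof -
    have "(R powr (- \<beta> * \<Phi> R)) ^ k = R powr (real k * (- \<beta> * \<Phi> R))"
      using R by (simp add: powr_powr powr_realpow[symmetric] mult.commute)
    also have "\<dots> \<le> R powr (- (\<beta> * (k + 1)) * \<Phi> R)"
      using R \<beta> \<Phi> by (intro powr_mono') (auto simp: dimension_function_def algebra_simps)
    finally have "D ^ k * (R powr (- \<beta> * \<Phi> R)) ^ k * measure \<mu> (ball y (2 * R / 2 ^ k))
        \<le> D ^ k * R powr (- (\<beta> * (k + 1)) * \<Phi> R) * measure \<mu> (ball y (2 * R / 2 ^ k))"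
      using D by (intro mult_right_mono mult_left_mono) auto
    thus ?thesis using iter[OF y R order_refl] by (simp add: power_mult_distrib)
  qed
  moreover have "0 < D ^ k" "0 < \<beta> * (k + 1)" using D \<beta> by auto
  ultimately show ?thesis by blast
qed

text \<open>
  The ball about \<open>x\<close> is enlarged to \<open>ball y (2 * R)\<close>, shrunk to \<open>ball y (\<epsilon> * R)\<close> by \<open>k\<close> halvings, and the
  remaining mass is transferred back to \<open>x\<close> by \<open>ball_transfer\<close>. The cost of the halvings is a
  power of \<open>R / \<eta>\<close> precisely because \<open>\<eta> < R powr (1 + \<Phi> R)\<close>.
\<close>

lemma finite_dim_if_Phi_doubling:
  assumes wsc: "weak_separation m r d"
    and \<Phi>: "dimension_function \<Phi>" and mono: "mono_on {0<..<1} \<Phi>"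
    and dbl: "doubling_function \<Phi>" and \<mu>: "Phi_doubling \<Phi> \<mu>"
  shows "upper_Phi_dim \<Phi> \<mu> < \<infinity>"
proof -
  obtain \<epsilon> C s where \<epsilon>: "0 < \<epsilon>" and C: "0 < C" "0 < s"
    and transfer: "\<forall>R x. 0 < R \<longrightarrow> R < 1 \<longrightarrow> x \<in> {0..1} \<longrightarrow>
    (\<exists>y\<in>{0..1}. \<bar>y - x\<bar> \<le> R \<and> (\<forall>\<eta>. 0 < \<eta> \<longrightarrow> \<eta> \<le> R \<longrightarrow>
      measure \<mu> (ball y (\<epsilon> * R)) * (\<eta> / R) powr s \<le> C * measure \<mu> (ball x \<eta>)))"
    using ball_transfer[OF wsc] by blast
  obtain k where k: "2 / \<epsilon> < 2 ^ k" using real_arch_pow[of 2 "2 / \<epsilon>"] by auto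
  obtain D \<beta> where D: "0 < D" "0 < \<beta>"
    and iter: "\<forall>y\<in>{0..1}. \<forall>R. 0 < R \<longrightarrow> R \<le> 1 / 4 \<longrightarrow>
    measure \<mu> (ball y (2 * R)) \<le> D * R powr (- \<beta> * \<Phi> R) * measure \<mu> (ball y (2 * R / 2 ^ k))"
    using iterated_Phi_doubling[OF \<Phi> mono dbl \<mu>, of k] by blast
  have "measure \<mu> (ball x R) / measure \<mu> (ball x \<eta>) \<le> (D * C) * (R / \<eta>) powr (\<beta> + s)"
    if \<eta>: "0 < \<eta>" "\<eta> < R powr (1 + \<Phi> R)" "R powr (1 + \<Phi> R) \<le> R" and R: "R \<le> 1 / 4" "0 < R"
      and x: "x \<in> {0..1}" for \<eta> R x
  proof -
    have \<eta>R: "\<eta> \<le> R" using \<eta> by linarith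
    have R1: "R < 1" using R by simp
    obtain y where y: "y \<in> {0..1}" "\<bar>y - x\<bar> \<le> R"
      and tr: "\<forall>\<eta>. 0 < \<eta> \<longrightarrow> \<eta> \<le> R \<longrightarrow>
        measure \<mu> (ball y (\<epsilon> * R)) * (\<eta> / R) powr s \<le> C * measure \<mu> (ball x \<eta>)"
      using transfer[rule_format, OF R(2) R1 x] by blast
    define B where "B = measure \<mu> (ball y (\<epsilon> * R))"
    define M where "M = measure \<mu> (ball x \<eta>)"
    have M: "0 < M" unfolding M_def using measure_ball_pos x \<eta> by blast
    have "B * (\<eta> / R) powr s \<le> C * M" using tr \<eta> \<eta>R by (simp add: B_def M_def)
    hence "B * ((\<eta> / R) powr s * (R / \<eta>) powr s) \<le> C * M * (R / \<eta>) powr s"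
      unfolding mult.assoc[symmetric] by (intro mult_right_mono) auto
    moreover have "(\<eta> / R) powr s * (R / \<eta>) powr s = 1"
      using \<eta> R by (simp add: powr_divide)
    ultimately have BM: "B \<le> C * M * (R / \<eta>) powr s" by simp
    have "R powr (- \<beta> * \<Phi> R) = (R powr (- \<Phi> R)) powr \<beta>" by (simp add: powr_powr mult.commute)
    also have "\<dots> \<le> (R / \<eta>) powr \<beta>"
    proof (intro powr_mono2)
      have "\<eta> * R powr (- \<Phi> R) \<le> R powr (1 + \<Phi> R) * R powr (- \<Phi> R)"
        using \<eta> by (intro mult_right_mono) auto
      also have "\<dots> = R" using R by (simp flip: powr_add)
      finally show "R powr (- \<Phi> R) \<le> R / \<eta>" using \<eta> by (simp add: pos_le_divide_eq mult.commute)
    qed (use D in auto)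
    finally have pw: "R powr (- \<beta> * \<Phi> R) \<le> (R / \<eta>) powr \<beta>" .
    have "2 * R / 2 ^ k \<le> \<epsilon> * R"
      using k \<epsilon> R by (simp add: field_simps)
    hence small: "measure \<mu> (ball y (2 * R / 2 ^ k)) \<le> B"
      unfolding B_def by (intro measure_mono subset_ball) auto
    have "ball x R \<subseteq> ball y (2 * R)" using y by (auto simp: dist_real_def)
    hence "measure \<mu> (ball x R) \<le> measure \<mu> (ball y (2 * R))" by (intro measure_mono) auto
    also have "\<dots> \<le> D * R powr (- \<beta> * \<Phi> R) * measure \<mu> (ball y (2 * R / 2 ^ k))"
      using iter y R by blast
    also have "\<dots> \<le> D * (R / \<eta>) powr \<beta> * (C * M * (R / \<eta>) powr s)"
      using D pw small BM by (intro mult_mono mult_left_mono) auto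
    also have "\<dots> = (D * C) * (R / \<eta>) powr (\<beta> + s) * M" by (simp add: powr_add mult_ac)
    finally show ?thesis using M by (simp add: pos_divide_le_eq M_def)
  qed
  hence "ereal (\<beta> + s) \<in> {ereal \<alpha> |\<alpha>.
     \<exists>C1>0. \<exists>C2>0. \<forall>r R. 0 < r \<and> r < R powr (1 + \<Phi> R) \<and> R powr (1 + \<Phi> R) \<le> R \<and> R \<le> C1 \<and> 0 < R \<and> R < 1 \<longrightarrow>
       (\<forall>x\<in>msupport \<mu>. measure \<mu> (ball x R) / measure \<mu> (ball x r) \<le> C2 * (R / r) powr \<alpha>)}"
    unfolding supp using D C
    by (intro CollectI exI[of _ "\<beta> + s"] conjI refl exI[of _ "1 / 4"] exI[of _ "D * C"]) auto
  hence "upper_Phi_dim \<Phi> \<mu> \<le> ereal (\<beta> + s)" unfolding upper_Phi_dim_def by (rule Inf_lower)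
  thus ?thesis by (rule le_less_trans) simp
qed

end

theorem proposition3p5:
  fixes m :: nat and r d p :: "nat \<Rightarrow> real" and \<mu> :: "real measure" and \<Phi> :: "real \<Rightarrow> real"
  assumes "self_similar_measure m r d p \<mu>"
    and "weak_separation m r d"
    and "msupport \<mu> = {0..1}"
    and "dimension_function \<Phi>"
    and "mono_on {0<..<1} \<Phi>"
    and "doubling_function \<Phi>"
  shows "upper_Phi_dim \<Phi> \<mu> < \<infinity> \<longleftrightarrow> Phi_doubling \<Phi> \<mu>"
proof -
  interpret self_similar_interval m r d p \<mu>
    using assms(1,3) by unfold_locales
  show ?thesis
    using Phi_doubling_if_finite_dim finite_dim_if_Phi_doubling assms by blast
qed

end
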